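(* Consider the third Painlevé equation $$w''=\frac{(w')^2}{w}-\frac{w'}{z}+\frac{\alpha w^2+\beta}{z}+\gamma w^3+\frac{\delta}{w},$$ with complex parameters satisfying $\alpha\beta\gamma\delta\neq0$, and its four formal power series solutions near $z=\infty$ $$\hat w_l=i^l\sqrt[4]{-\frac{\delta}{\gamma}}-\left(\frac{(-1)^l\beta}{4\sqrt{-\gamma\delta}}+\frac{\alpha}{4\gamma}\right)\frac1z+\sum_{k=2}^{\infty}\frac{c_{l,k}}{z^k},\qquad l=1,2,3,4,$$ where $i^2=-1$. Then the series $\hat w_1,\hat w_2,\hat w_3,\hat w_4$ are of Gevrey order $1$. Moreover, there exist $k'\ge1$ and $R_0\in\mathbb{R}_+$ such that for any open sector $V=\{z:|z|>R,\ \mathrm{Arg}\,z\in(\varphi_1,\varphi_2)\}$ with $R\ge R_0$ and $\varphi_2-\varphi_1<\pi/k'\le\pi$, and for each $l\in\{1,2,3,4\}$, there exists a solution of the third Painlevé equation on $V$ which is asymptotically approximated of Gevrey order $1$ on $V$ by the series $\hat w_l$.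
   Context: Sectors are taken in the complex plane or on the Riemann surface of the logarithm, with vertex at infinity; "solution on $V$" means a function holomorphic on $V$ satisfying the equation. Formal solutions: $\sqrt[4]{-\delta/\gamma}$ is the principal branch of the fourth root, and $\sqrt{-\gamma\delta}$ denotes the square root equal to $\gamma\left(\sqrt[4]{-\delta/\gamma}\right)^2$. The coefficients $c_{l,k}\in\mathbb{C}$ are the constants for which $\hat w_l$ is a formal solution of the equation, i.e. satisfies formally the equation multiplied by $zw$; they are uniquely determined by the parameters and $l$. Gevrey order: a formal series $\sum_{k\ge0}a_kz^{-k}$ is of Gevrey order $1$ if there are constants $C,A>0$ with $|a_n|\le C\,n!\,A^n$ for all $n\ge0$. Gevrey approximation: a function $w$ holomorphic on an open sector $V$ at infinity is asymptotically approximated of Gevrey order $1$ on $V$ by a formal series $\sum_{k\ge0}a_kz^{-k}$ if there are a constant $C>0$ and, for every closed subsector $Y$ of $V$, a constant $A_Y>0$ such that for all $z\in Y$ and all integers $n\ge1$ $$|z|^n\left|w(z)-\sum_{p=0}^{n-1}a_pz^{-p}\right|<C\,n!\,A_Y^n .$$ *)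

theory Defs
  imports "HOL-Complex_Analysis.Complex_Analysis"
begin

definition piii_solution_on ::
    "complex \<Rightarrow> complex \<Rightarrow> complex \<Rightarrow> complex \<Rightarrow> (complex \<Rightarrow> complex) \<Rightarrow> complex set \<Rightarrow> bool" where
  "piii_solution_on \<alpha> \<beta> \<gamma> \<delta> w V \<longleftrightarrow>
     w holomorphic_on V \<and>
     (\<forall>z\<in>V. w z \<noteq> 0 \<and>
        deriv (deriv w) z =
          (deriv w z)\<^sup>2 / w z - deriv w z / z + (\<alpha> * (w z)\<^sup>2 + \<beta>) / z
          + \<gamma> * w z ^ 3 + \<delta> / w z)"

text \<open>
  A formal series \<open>\<Sum>k. a k / z ^ k\<close> is represented by the power series with coefficients \<open>a k\<close>
  in the indeterminate \<open>X = 1 / z\<close>. Hence \<open>z\<close> itself is the Laurent series \<^const>\<open>fls_X_inv\<close>,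
  and by the chain rule \<open>d/dz = - X\<^sup>2 d/dX\<close>.
\<close>

definition fls_deriv_z :: "complex fls \<Rightarrow> complex fls" where
  "fls_deriv_z F = - (fls_X\<^sup>2 * fls_deriv F)"

text \<open>The equation multiplied by \<open>z w\<close>.\<close>

definition piii_formal_solution ::
    "complex \<Rightarrow> complex \<Rightarrow> complex \<Rightarrow> complex \<Rightarrow> complex fps \<Rightarrow> bool" where
  "piii_formal_solution \<alpha> \<beta> \<gamma> \<delta> F \<longleftrightarrow>
     (let w = fps_to_fls F; z = fls_X_inv in
        z * w * fls_deriv_z (fls_deriv_z w) =
          z * (fls_deriv_z w)\<^sup>2 - w * fls_deriv_z w
          + w * (fls_const \<alpha> * w\<^sup>2 + fls_const \<beta>)
          + fls_const \<gamma> * z * w ^ 4 + fls_const \<delta> * z)"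

definition piii_root4 :: "complex \<Rightarrow> complex \<Rightarrow> complex" where
  "piii_root4 \<gamma> \<delta> = (- \<delta> / \<gamma>) powr (1 / 4)"

text \<open>The square root of \<open>- \<gamma> \<delta>\<close> determined by the choice of the fourth root.\<close>

definition piii_sqrt :: "complex \<Rightarrow> complex \<Rightarrow> complex" where
  "piii_sqrt \<gamma> \<delta> = \<gamma> * (piii_root4 \<gamma> \<delta>)\<^sup>2"

definition is_piii_series ::
    "complex \<Rightarrow> complex \<Rightarrow> complex \<Rightarrow> complex \<Rightarrow> nat \<Rightarrow> complex fps \<Rightarrow> bool" where
  "is_piii_series \<alpha> \<beta> \<gamma> \<delta> l F \<longleftrightarrow>
     fps_nth F 0 = \<i> ^ l * piii_root4 \<gamma> \<delta> \<and>
     fps_nth F 1 = - ((-1) ^ l * \<beta> / (4 * piii_sqrt \<gamma> \<delta>) + \<alpha> / (4 * \<gamma>)) \<and>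
     piii_formal_solution \<alpha> \<beta> \<gamma> \<delta> F"

text \<open>
  The description is proper when \<open>\<gamma>\<close> and \<open>\<delta>\<close> are nonzero, see \<open>ex1_piii_series\<close> below.
\<close>

definition piii_series ::
    "complex \<Rightarrow> complex \<Rightarrow> complex \<Rightarrow> complex \<Rightarrow> nat \<Rightarrow> complex fps" where
  "piii_series \<alpha> \<beta> \<gamma> \<delta> l = (THE F. is_piii_series \<alpha> \<beta> \<gamma> \<delta> l F)"

definition gevrey_order_1 :: "complex fps \<Rightarrow> bool" where
  "gevrey_order_1 F \<longleftrightarrow>
     (\<exists>C>0. \<exists>A>0. \<forall>n. norm (fps_nth F n) \<le> C * fact n * A ^ n)"

text \<open>
  Sectors with vertex at infinity. \<^const>\<open>is_Arg\<close> admits every value of the argument, so the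
  bounds on \<open>\<theta>\<close> are arbitrary reals. A sector of opening less than \<open>2 * pi\<close> on the Riemann
  surface of the logarithm projects bijectively onto such a set.
\<close>

definition open_sector_inf :: "real \<Rightarrow> real \<Rightarrow> real \<Rightarrow> complex set" where
  "open_sector_inf R \<phi>1 \<phi>2 = {z. norm z > R \<and> (\<exists>\<theta>. is_Arg z \<theta> \<and> \<phi>1 < \<theta> \<and> \<theta> < \<phi>2)}"

definition closed_sector_inf :: "real \<Rightarrow> real \<Rightarrow> real \<Rightarrow> complex set" where
  "closed_sector_inf R \<psi>1 \<psi>2 = {z. norm z \<ge> R \<and> (\<exists>\<theta>. is_Arg z \<theta> \<and> \<psi>1 \<le> \<theta> \<and> \<theta> \<le> \<psi>2)}"

definition closed_subsector :: "complex set \<Rightarrow> complex set \<Rightarrow> bool" where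
  "closed_subsector Y V \<longleftrightarrow>
     Y \<subseteq> V \<and> (\<exists>R>0. \<exists>\<psi>1 \<psi>2. \<psi>1 \<le> \<psi>2 \<and> Y = closed_sector_inf R \<psi>1 \<psi>2)"

definition gevrey_1_approx_on :: "(complex \<Rightarrow> complex) \<Rightarrow> complex fps \<Rightarrow> complex set \<Rightarrow> bool" where
  "gevrey_1_approx_on w F V \<longleftrightarrow>
     (\<exists>C>0. \<forall>Y. closed_subsector Y V \<longrightarrow>
        (\<exists>A>0. \<forall>z\<in>Y. \<forall>n\<ge>1.
           norm z ^ n * norm (w z - (\<Sum>p<n. fps_nth F p / z ^ p)) < C * fact n * A ^ n))"


definition fps_agree :: "nat \<Rightarrow> complex fps \<Rightarrow> complex fps \<Rightarrow> bool" where
  "fps_agree n F G \<longleftrightarrow> (\<forall>k<n. fps_nth F k = fps_nth G k)"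

lemma fps_agree_mult: "fps_agree n F G \<Longrightarrow> fps_agree n F' G' \<Longrightarrow> fps_agree n (F * F') (G * G')"
  by (auto simp: fps_agree_def fps_mult_nth intro!: sum.cong)

lemma fps_agree_power: "fps_agree n F G \<Longrightarrow> fps_agree n (F ^ k) (G ^ k)"
  by (induction k) (simp_all add: fps_agree_mult, simp add: fps_agree_def)

lemma fps_agree_theta:
  "fps_agree n F G \<Longrightarrow> fps_agree n (fps_X * fps_deriv F) (fps_X * fps_deriv G)"
  by (auto simp: fps_agree_def)

lemma fps_agree_X: "fps_agree n F G \<Longrightarrow> fps_agree (Suc n) (fps_X * F) (fps_X * G)"
  by (auto simp: fps_agree_def)

lemma fps_agree_add: "fps_agree n F G \<Longrightarrow> fps_agree n F' G' \<Longrightarrow> fps_agree n (F + F') (G + G')"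
  and fps_agree_diff: "fps_agree n F G \<Longrightarrow> fps_agree n F' G' \<Longrightarrow> fps_agree n (F - F') (G - G')"
  and fps_agree_refl: "fps_agree n F F"
  and fps_agree_mono: "fps_agree m F G \<Longrightarrow> n \<le> m \<Longrightarrow> fps_agree n F G"
  by (auto simp: fps_agree_def)

definition piii_rhs :: "complex \<Rightarrow> complex \<Rightarrow> complex fps \<Rightarrow> complex fps" where
  "piii_rhs \<alpha> \<beta> F =
     fps_X * (F * (fps_X * fps_deriv (fps_X * fps_deriv F)) - (fps_X * fps_deriv F)\<^sup>2)
     - fps_const \<alpha> * F ^ 3 - fps_const \<beta> * F"

lemma fps_agree_piii_rhs:
  assumes "fps_agree n F G"
  shows "fps_agree n (piii_rhs \<alpha> \<beta> F) (piii_rhs \<alpha> \<beta> G)"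
  unfolding piii_rhs_def
  by (intro fps_agree_diff fps_agree_mult fps_agree_power fps_agree_theta fps_agree_refl assms)

lemma piii_formal_solution_iff:
  "piii_formal_solution \<alpha> \<beta> \<gamma> \<delta> F \<longleftrightarrow>
     fps_const \<gamma> * F ^ 4 + fps_const \<delta> = fps_X * piii_rhs \<alpha> \<beta> F"
proof -
  define w where "w = fps_to_fls F"
  define X :: "complex fls" where "X = fls_X"
  define Z :: "complex fls" where "Z = fls_X_inv"
  have XZ: "X * Z = 1" and X0: "X \<noteq> 0"
    by (auto simp: X_def Z_def fls_X_times_conv_shift fls_X_inv_times_conv_shift)
  have dX: "fls_deriv X = 1" by (simp add: X_def)
  let ?D = "fls_deriv w" and ?DD = "fls_deriv (fls_deriv w)"
  have d1: "fls_deriv_z w = - (X\<^sup>2 * ?D)" by (simp add: fls_deriv_z_def X_def)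
  have d2: "fls_deriv_z (fls_deriv_z w) = X ^ 4 * ?DD + 2 * X ^ 3 * ?D"
    by (simp add: d1) (simp add: fls_deriv_z_def X_def[symmetric] dX power2_eq_square algebra_simps eval_nat_numeral)
  have emb: "fps_to_fls (fps_X * piii_rhs \<alpha> \<beta> F) =
     X * (X * (w * (X * (?D + X * ?DD)) - (X * ?D)\<^sup>2) - fls_const \<alpha> * w ^ 3 - fls_const \<beta> * w)"
    by (simp add: piii_rhs_def w_def X_def fls_times_fps_to_fls fps_to_fls_power fls_deriv_fps_to_fls algebra_simps)
  have emb2: "fps_to_fls (fps_const \<gamma> * F ^ 4 + fps_const \<delta>) = fls_const \<gamma> * w ^ 4 + fls_const \<delta>"
    by (simp add: w_def fls_times_fps_to_fls fps_to_fls_power)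
  let ?L = "Z * w * (X ^ 4 * ?DD + 2 * X ^ 3 * ?D)"
  let ?R = "Z * (X\<^sup>2 * ?D)\<^sup>2 + w * (X\<^sup>2 * ?D) + w * (fls_const \<alpha> * w\<^sup>2 + fls_const \<beta>)
             + fls_const \<gamma> * Z * w ^ 4 + fls_const \<delta> * Z"
  have "piii_formal_solution \<alpha> \<beta> \<gamma> \<delta> F \<longleftrightarrow> ?L = ?R"
    unfolding piii_formal_solution_def Let_def w_def[symmetric] Z_def[symmetric] d2 unfolding d1 by simp
  also have "\<dots> \<longleftrightarrow> X * ?L = X * ?R"
    using X0 by simp
  also have "X * ?L = w * (X ^ 4 * ?DD + 2 * X ^ 3 * ?D)"
    using XZ by algebra
  also have "X * ?R = (X\<^sup>2 * ?D)\<^sup>2 + X * (w * (X\<^sup>2 * ?D) + w * (fls_const \<alpha> * w\<^sup>2 + fls_const \<beta>))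
             + fls_const \<gamma> * w ^ 4 + fls_const \<delta>"
    using XZ by algebra
  also have "w * (X ^ 4 * ?DD + 2 * X ^ 3 * ?D) = \<dots> \<longleftrightarrow>
     fls_const \<gamma> * w ^ 4 + fls_const \<delta> =
     X * (X * (w * (X * (?D + X * ?DD)) - (X * ?D)\<^sup>2) - fls_const \<alpha> * w ^ 3 - fls_const \<beta> * w)"
    by (rule iffI; algebra)
  also have "\<dots> \<longleftrightarrow> fps_const \<gamma> * F ^ 4 + fps_const \<delta> = fps_X * piii_rhs \<alpha> \<beta> F"
    unfolding emb[symmetric] emb2[symmetric] by (simp only: fps_to_fls_eq_iff)
  finally show ?thesis .
qed

lemma ex1_piii_fps:
  assumes "\<gamma> * a ^ 4 + \<delta> = 0" "\<gamma> \<noteq> 0" "a \<noteq> 0"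
  shows "\<exists>!F. fps_nth F 0 = a \<and> fps_const \<gamma> * F ^ 4 + fps_const \<delta> = fps_X * piii_rhs \<alpha> \<beta> F"
proof -
  define c where "c = 1 / (4 * \<gamma> * a ^ 3)"
  have c: "c \<noteq> 0" "4 * c * \<gamma> * a ^ 3 = 1" using assms by (auto simp: c_def)
  define \<Phi> where "\<Phi> F = F - fps_const c *
      (fps_const \<gamma> * F ^ 4 + fps_const \<delta> - fps_X * piii_rhs \<alpha> \<beta> F)" for F
  have fix_iff: "fps_const \<gamma> * F ^ 4 + fps_const \<delta> = fps_X * piii_rhs \<alpha> \<beta> F \<longleftrightarrow> \<Phi> F = F" for F
    using c(1) by (simp add: \<Phi>_def)
  have \<Phi>0: "fps_nth (\<Phi> F) 0 = a" if "fps_nth F 0 = a" for F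
    using assms(1) that by (simp add: \<Phi>_def fps_nth_power_0)
  have contr: "fps_agree (Suc n) (\<Phi> F) (\<Phi> G)"
    if "fps_nth F 0 = a" "fps_nth G 0 = a" "fps_agree n F G" for F G n
  proof -
    define S where "S = F ^ 3 + F\<^sup>2 * G + F * G\<^sup>2 + G ^ 3"
    define T where "T = 1 - fps_const (c * \<gamma>) * S"
    have "fps_nth S 0 = 4 * a ^ 3"
      using that by (simp add: S_def eval_nat_numeral)
    then have T0: "fps_nth T 0 = 0" using c(2) by (simp add: T_def mult_ac)
    have "fps_agree (Suc n) ((F - G) * T) 0"
      unfolding fps_agree_def
    proof (intro allI impI)
      fix k assume k: "k < Suc n"
      have "fps_nth (F - G) i * fps_nth T (k - i) = 0" if "i \<le> k" for i
      proof (cases "i < n")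
        case True
        then show ?thesis using \<open>fps_agree n F G\<close> by (simp add: fps_agree_def)
      next
        case False
        then have "k - i = 0" using k by simp
        then show ?thesis using T0 by simp
      qed
      then show "fps_nth ((F - G) * T) k = fps_nth 0 k"
        unfolding fps_mult_nth by (subst sum.neutral) auto
    qed
    moreover have "fps_agree (Suc n) (fps_const c * (fps_X * piii_rhs \<alpha> \<beta> F))
                     (fps_const c * (fps_X * piii_rhs \<alpha> \<beta> G))"
      by (intro fps_agree_mult fps_agree_X fps_agree_piii_rhs that fps_agree_refl)
    moreover have "\<Phi> F - \<Phi> G = (F - G) * T + (fps_const c * (fps_X * piii_rhs \<alpha> \<beta> F)
                     - fps_const c * (fps_X * piii_rhs \<alpha> \<beta> G))"
      by (simp add: \<Phi>_def T_def S_def fps_const_mult[symmetric] algebra_simps eval_nat_numeral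
               del: fps_const_mult)
    ultimately have "\<forall>k<Suc n. fps_nth (\<Phi> F - \<Phi> G) k = 0"
      by (simp add: fps_agree_def)
    then show ?thesis by (simp add: fps_agree_def)
  qed
  define It where "It n = (\<Phi> ^^ n) (fps_const a)" for n
  have It0: "fps_nth (It n) 0 = a" for n
    by (induction n) (auto simp: It_def \<Phi>0)
  have step: "fps_agree (Suc n) (It n) (It (Suc n))" for n
  proof (induction n)
    case 0
    then show ?case using It0 by (simp add: fps_agree_def)
  next
    case (Suc n)
    then show ?case using contr[OF It0 It0 Suc] by (simp add: It_def)
  qed
  have stable: "fps_agree (Suc n) (It n) (It (n + m))" for n m
  proof (induction m)
    case 0
    then show ?case by (simp add: fps_agree_refl)
  next
    case (Suc m)
    then show ?case using step[of "n + m"] by (auto simp: fps_agree_def)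
  qed
  define L where "L = Abs_fps (\<lambda>n. fps_nth (It n) n)"
  have LIt: "fps_agree (Suc n) L (It n)" for n
    unfolding fps_agree_def
  proof (intro allI impI)
    fix k assume "k < Suc n"
    then show "fps_nth L k = fps_nth (It n) k"
      using stable[of k "n - k"] by (simp add: L_def fps_agree_def)
  qed
  have L0: "fps_nth L 0 = a" by (simp add: L_def It0)
  have "\<Phi> L = L"
  proof (rule fps_ext)
    fix n
    have "fps_nth (\<Phi> L) n = fps_nth (\<Phi> (It n)) n"
      using contr[OF L0 It0 LIt[of n]] by (simp add: fps_agree_def)
    also have "\<dots> = fps_nth (It (Suc n)) n" by (simp add: It_def)
    also have "\<dots> = fps_nth L n" using LIt[of "Suc n"] by (simp add: fps_agree_def)
    finally show "fps_nth (\<Phi> L) n = fps_nth L n" .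
  qed
  moreover have "F = L" if "fps_nth F 0 = a" "\<Phi> F = F" for F
  proof -
    have "fps_agree n F L" for n
    proof (induction n)
      case 0
      then show ?case by (simp add: fps_agree_def)
    next
      case (Suc n)
      then show ?case using contr[OF that(1) L0 Suc] that(2) \<open>\<Phi> L = L\<close> by simp
    qed
    then show ?thesis by (auto simp: fps_agree_def fps_eq_iff)
  qed
  ultimately show ?thesis
    unfolding fix_iff using L0 by blast
qed

theorem ex1_piii_series:
  assumes "\<gamma> \<noteq> 0" "\<delta> \<noteq> 0"
  shows "\<exists>!F. is_piii_series \<alpha> \<beta> \<gamma> \<delta> l F"
proof -
  define r where "r = piii_root4 \<gamma> \<delta>"
  define a where "a = \<i> ^ l * r"
  have r0: "r \<noteq> 0" using assms by (simp add: r_def piii_root4_def)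
  have "r ^ 4 = (- \<delta> / \<gamma>) powr 1"
    unfolding r_def piii_root4_def by (simp flip: powr_add add: eval_nat_numeral)
  then have r4: "r ^ 4 = - \<delta> / \<gamma>" using assms by simp
  have a0: "a \<noteq> 0" using r0 by (simp add: a_def)
  have i4: "(\<i> ^ l) ^ 4 = 1"
  proof -
    have "(\<i> ^ l) ^ 4 = (\<i> ^ 4) ^ l" by (simp only: power_mult[symmetric] mult.commute)
    also have "\<i> ^ 4 = (1 :: complex)" by (simp add: eval_nat_numeral)
    finally show ?thesis by simp
  qed
  have a4: "\<gamma> * a ^ 4 + \<delta> = 0"
    using assms by (simp add: a_def power_mult_distrib i4 r4)
  have a2: "a\<^sup>2 = (-1) ^ l * r\<^sup>2"
    by (simp add: a_def power_mult_distrib flip: power_mult)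
  have c1: "fps_nth F 1 = - ((-1) ^ l * \<beta> / (4 * piii_sqrt \<gamma> \<delta>) + \<alpha> / (4 * \<gamma>))"
    if F0: "fps_nth F 0 = a" and F: "fps_const \<gamma> * F ^ 4 + fps_const \<delta> = fps_X * piii_rhs \<alpha> \<beta> F" for F
  proof -
    have "fps_nth (F ^ 4) 1 = 4 * a ^ 3 * fps_nth F 1"
      using F0 by (simp add: eval_nat_numeral fps_mult_nth algebra_simps)
    then have "\<gamma> * (4 * a ^ 3 * fps_nth F 1) = fps_nth (fps_const \<gamma> * F ^ 4 + fps_const \<delta>) 1"
      by simp
    also have "\<dots> = - \<alpha> * a ^ 3 - \<beta> * a"
      unfolding F using F0 by (simp add: piii_rhs_def fps_nth_power_0)
    finally have "fps_nth F 1 = (- \<alpha> * a ^ 3 - \<beta> * a) / (4 * \<gamma> * a ^ 3)"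
      using a0 assms by (simp add: field_simps)
    also have "\<dots> = - (\<beta> / (4 * \<gamma> * a\<^sup>2) + \<alpha> / (4 * \<gamma>))"
      using a0 assms by (simp add: field_simps eval_nat_numeral)
    also have "\<beta> / (4 * \<gamma> * a\<^sup>2) = (-1) ^ l * \<beta> / (4 * piii_sqrt \<gamma> \<delta>)"
      unfolding a2 piii_sqrt_def r_def[symmetric]
      by (cases "even l") simp_all
    finally show ?thesis .
  qed
  show ?thesis
    using ex1_piii_fps[OF a4 assms(1) a0, of \<alpha> \<beta>] c1
    unfolding is_piii_series_def piii_formal_solution_iff r_def[symmetric] a_def[symmetric]
    by metis
qed

end

theory Submission
  imports Defs "HOL-Library.Landau_Symbols"
begin

text \<open>
  Each formal solution is Borel summable, and the proof produces its Borel transform directly. Write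
  \<open>w = a + u\<close>, where \<open>a\<close> is the leading coefficient, \<open>\<gamma> a\<^sup>4 + \<delta> = 0\<close>, and look for \<open>u\<close> as a Laplace
  transform \<open>u(z) = \<integral> exp(- z \<zeta>) f(\<zeta>) d\<zeta>\<close> along a ray \<open>{t e | t \<ge> 0}\<close>. Products become convolutions,
  \<open>d/dz\<close> becomes multiplication by \<open>- \<zeta>\<close> and \<open>1/z\<close> becomes the constant \<open>1\<close>; the linear part
  \<open>a u'' - 4 \<gamma> a\<^sup>3 u\<close> of the equation becomes multiplication by \<open>a (\<zeta>\<^sup>2 - 4 \<gamma> a\<^sup>2)\<close>. So the equation
  turns into a fixed point problem \<open>f = (const + N f) / (a (\<zeta>\<^sup>2 - 4 \<gamma> a\<^sup>2))\<close> in which every term of \<open>N f\<close>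
  contains a convolution.

  The only singular points are \<open>\<zeta> = \<plusminus> 2 a sqrt \<gamma>\<close>. On an open strip around a ray that avoids them the
  quotients of \<open>1\<close>, \<open>\<zeta>\<close>, \<open>\<zeta>\<^sup>2\<close> by the symbol are bounded, and in a sup-norm with
  weight \<open>exp(c r) / (1 + c r)\<^sup>2\<close> a convolution costs a factor \<open>O(1/c)\<close> (\<open>norm_conv_le\<close>). For large
  \<open>c\<close> the problem is a contraction (\<open>piii_convolution_equation_solvable\<close>), and its solution \<open>f\<close> is
  holomorphic on the whole strip and of exponential growth.

  A function of exponential growth that is holomorphic on a strip of fixed width around the ray has
  derivatives of size \<open>n! \<rho>\<^sup>-\<^sup>n exp(c t)\<close> on the ray, by Cauchy's inequality. Repeated partial
  integration then gives Gevrey asymptotics of order \<open>1\<close> for its Laplace transform, uniformly on a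
  half-plane, with the series \<open>\<Sum> f\<^sup>(\<^sup>k\<^sup>)(0) / z\<^sup>k\<^sup>+\<^sup>1\<close> (\<open>lap_gevrey_asymptotics\<close>).
  That \<open>a\<close> plus this series is the formal solution follows from the differential equation itself:
  asymptotic expansions of \<open>w\<close>, \<open>w'\<close>, \<open>w''\<close> can be multiplied and are unique
  (\<open>half_plane_solution\<close>). The formal solution with given leading coefficient is unique, so this is
  the series in question (\<open>piii_series_eqI\<close>), and the bounds on the derivatives at \<open>0\<close> show
  that it is of Gevrey order \<open>1\<close>.

  Finally, four directions \<open>e\<close> suffice, those with \<open>e\<^sup>2\<close> perpendicular to \<open>\<gamma> a\<^sup>2\<close>: they are spaced by
  right angles, so every sector of opening less than \<open>pi / 4\<close> lies, far enough out, in one of the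
  four half-planes on which a solution was found. Four directions and four series give finitely many
  radii, whence a common \<open>R0\<close>.
\<close>

section \<open>Convolution along segments from the origin\<close>

text \<open>
  The convolution \<open>\<integral> f(\<zeta> - s) g(s) ds\<close> over the segment from \<open>0\<close> to \<open>\<zeta>\<close>, with the segment
  parametrised by \<open>s = t \<zeta>\<close>. In this form it makes sense on every domain that is star-shaped
  about the origin, and \<open>\<zeta>\<close> enters as a parameter of an integral over a fixed interval.
\<close>
definition conv :: "(complex \<Rightarrow> complex) \<Rightarrow> (complex \<Rightarrow> complex) \<Rightarrow> complex \<Rightarrow> complex" where
  "conv f g \<zeta> = \<zeta> * integral {0..1} (\<lambda>t. f ((1 - t) *\<^sub>R \<zeta>) * g (t *\<^sub>R \<zeta>))"

lemma scaleR_in_convex: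
  fixes \<zeta> :: "'a::real_vector"
  assumes "convex D" "0 \<in> D" "\<zeta> \<in> D" "0 \<le> t" "t \<le> 1"
  shows "t *\<^sub>R \<zeta> \<in> D"
proof -
  have "t *\<^sub>R \<zeta> + (1 - t) *\<^sub>R 0 \<in> D"
    using assms by (intro convexD) auto
  then show ?thesis by simp
qed

lemma conv_integrand_continuous:
  fixes f g :: "complex \<Rightarrow> complex"
  assumes D: "convex D" "0 \<in> D" "\<zeta> \<in> D"
    and "continuous_on D f" "continuous_on D g"
  shows "continuous_on {0..1} (\<lambda>t::real. f ((1 - t) *\<^sub>R \<zeta>) * g (t *\<^sub>R \<zeta>))"
proof -
  have 1: "continuous_on {0..1} (\<lambda>t::real. f ((1 - t) *\<^sub>R \<zeta>))"
    by (rule continuous_on_compose2[OF assms(4)])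
       (auto intro!: continuous_intros scaleR_in_convex[OF D])
  have 2: "continuous_on {0..1} (\<lambda>t::real. g (t *\<^sub>R \<zeta>))"
    by (rule continuous_on_compose2[OF assms(5)])
       (auto intro!: continuous_intros scaleR_in_convex[OF D])
  show ?thesis
    using 1 2 by (intro continuous_intros)
qed

lemma holomorphic_conv:
  assumes D: "open D" "convex D" "0 \<in> D"
    and f: "f holomorphic_on D" and g: "g holomorphic_on D"
  shows "conv f g holomorphic_on D"
proof -
  define G' where "G' \<zeta> t = of_real (1 - t) * deriv f ((1 - t) *\<^sub>R \<zeta>) * g (t *\<^sub>R \<zeta>)
      + of_real t * f ((1 - t) *\<^sub>R \<zeta>) * deriv g (t *\<^sub>R \<zeta>)" for \<zeta> :: complex and t :: real
  note [simp] = cbox_interval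
  have mem: "t *\<^sub>R \<zeta> \<in> D" "(1 - t) *\<^sub>R \<zeta> \<in> D" if "\<zeta> \<in> D" "t \<in> {0..1}" for \<zeta> and t :: real
    using that scaleR_in_convex[OF D(2,3)] by auto
  have df: "(f has_field_derivative deriv f x) (at x)"
       and dg: "(g has_field_derivative deriv g x) (at x)" if "x \<in> D" for x
    using f g D(1) that holomorphic_derivI by blast+
  have "(\<lambda>\<zeta>. integral (cbox 0 1) (\<lambda>t::real. f ((1 - t) *\<^sub>R \<zeta>) * g (t *\<^sub>R \<zeta>))) holomorphic_on D"
  proof (rule leibniz_rule_holomorphic[OF _ _ _ D(2)])
    fix \<zeta> and t :: real assume \<zeta>: "\<zeta> \<in> D" and t: "t \<in> cbox 0 1"
    have "((\<lambda>\<zeta>. f (of_real (1 - t) * \<zeta>) * g (of_real t * \<zeta>)) has_field_derivative G' \<zeta> t) (at \<zeta>)"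
      unfolding G'_def scaleR_conv_of_real
      by (rule derivative_eq_intros DERIV_chain2[OF df] DERIV_chain2[OF dg] refl
          | use mem[OF \<zeta>, of t] t in \<open>simp add: scaleR_conv_of_real\<close>)+
    then show "((\<lambda>\<zeta>. f ((1 - t) *\<^sub>R \<zeta>) * g (t *\<^sub>R \<zeta>)) has_field_derivative G' \<zeta> t) (at \<zeta> within D)"
      unfolding scaleR_conv_of_real by (rule has_field_derivative_at_within)
  next
    fix \<zeta> assume "\<zeta> \<in> D"
    then show "(\<lambda>t::real. f ((1 - t) *\<^sub>R \<zeta>) * g (t *\<^sub>R \<zeta>)) integrable_on cbox 0 1"
      using conv_integrand_continuous[OF D(2,3)] f g
      by (auto intro!: integrable_continuous_real holomorphic_on_imp_continuous_on)
  next
    have c: "continuous_on (D \<times> {0..1}) (\<lambda>x. h (snd x *\<^sub>R fst x))"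
            "continuous_on (D \<times> {0..1}) (\<lambda>x. h ((1 - snd x) *\<^sub>R fst x))"
      if "h holomorphic_on D" for h :: "complex \<Rightarrow> complex"
      by (rule continuous_on_compose2[OF holomorphic_on_imp_continuous_on[OF that]];
          use mem in \<open>auto intro!: continuous_intros\<close>)+
    show "continuous_on (D \<times> cbox 0 1) (\<lambda>(\<zeta>, t). G' \<zeta> t)"
      unfolding G'_def case_prod_unfold
      using c[OF f] c[OF g] c[OF holomorphic_deriv[OF f D(1)]] c[OF holomorphic_deriv[OF g D(1)]]
      by (auto intro!: continuous_intros)
  qed
  then have "(\<lambda>\<zeta>. \<zeta> * integral {0..1} (\<lambda>t. f ((1 - t) *\<^sub>R \<zeta>) * g (t *\<^sub>R \<zeta>))) holomorphic_on D"
    by (intro holomorphic_intros) simp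
  then show ?thesis
    by (simp add: conv_def[abs_def])
qed

text \<open>
  The exponential makes functions with such a bound Laplace transformable. The denominator is there
  because \<open>exp(c r)\<close> alone is not stable under convolution: it would produce \<open>r exp(c r)\<close>.
\<close>
definition weight :: "real \<Rightarrow> real \<Rightarrow> real" where
  "weight c r = exp (c * r) / (1 + c * r)\<^sup>2"

lemma weight_nonneg: "0 \<le> weight c r"
  by (simp add: weight_def)

lemma weight_le_exp: "c \<ge> 0 \<Longrightarrow> r \<ge> 0 \<Longrightarrow> weight c r \<le> exp (c * r)"
  unfolding weight_def
  by (rule divide_le_eq[THEN iffD2]) (auto intro!: mult_right_le_one_le[THEN order_trans] simp: one_le_power mult_le_cancel_left1 add_nonneg_pos)

lemma weight_ge: "c \<ge> 0 \<Longrightarrow> r \<ge> 0 \<Longrightarrow> 1 \<le> 4 * weight c r"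
proof -
  assume "c \<ge> 0" "r \<ge> 0"
  then have "0 \<le> c * r" by simp
  have "(1 + c * r) / 2 \<le> exp (c * r / 2)"
    using exp_ge_add_one_self[of "c * r / 2"] by (simp add: field_simps)
  then have "((1 + c * r) / 2)\<^sup>2 \<le> exp (c * r / 2) ^ 2"
    using \<open>0 \<le> c * r\<close> by (intro power_mono) auto
  also have "\<dots> = exp (c * r)"
    by (simp flip: exp_double)
  finally show ?thesis
    using \<open>0 \<le> c * r\<close> by (simp add: weight_def le_divide_eq power_divide)
qed

lemma continuous_on_weight:
  assumes "c \<ge> 0" "continuous_on S r" "\<And>x. x \<in> S \<Longrightarrow> r x \<ge> 0"
  shows "continuous_on S (\<lambda>x. weight c (r x))"
proof -
  have "1 + c * r x \<noteq> 0" if "x \<in> S" for x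
    using assms(1) assms(3)[OF that] by (smt (verit) mult_nonneg_nonneg)
  then show ?thesis
    unfolding weight_def using assms(2) by (auto intro!: continuous_intros)
qed

lemma has_integral_inverse_square:
  fixes x :: real
  assumes "x \<ge> 0"
  shows "((\<lambda>t. x / (1 + x * t)\<^sup>2) has_integral (1 - 1 / (1 + x))) {0..1}"
proof -
  have p: "1 + x * t \<noteq> 0" if "t \<in> {0..1}" for t
  proof -
    have "0 \<le> x * t" using assms that by (intro mult_nonneg_nonneg) auto
    then show ?thesis by linarith
  qed
  have "((\<lambda>t. x / (1 + x * t)\<^sup>2) has_integral ((- 1 / (1 + x * 1)) - (- 1 / (1 + x * 0)))) {0..1}"
  proof (rule fundamental_theorem_of_calculus)
    fix t :: real assume "t \<in> {0..1}"
    then show "((\<lambda>t. - 1 / (1 + x * t)) has_vector_derivative x / (1 + x * t)\<^sup>2) (at t within {0..1})"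
      using p[of t] unfolding has_real_derivative_iff_has_vector_derivative[symmetric]
      by (auto intro!: derivative_eq_intros simp: power2_eq_square divide_simps)
  qed simp
  then show ?thesis by simp
qed

text \<open>
  In terms of \<open>x = c r\<close> the exponentials multiply to \<open>exp x\<close>, and with \<open>A = 1 + x (1 - t)\<close>,
  \<open>B = 1 + x t\<close> we have \<open>A + B = 2 + x\<close>, hence \<open>1 / (A B) = (1 / A + 1 / B) / (2 + x)\<close>. The square of
  this is at most \<open>2 (1 / A\<^sup>2 + 1 / B\<^sup>2) / (1 + x)\<^sup>2\<close>, and both \<open>x / A\<^sup>2\<close> and \<open>x / B\<^sup>2\<close> have integral
  less than \<open>1\<close>.
\<close>
lemma integral_weight_conv_le:
  assumes "c > 0" "r \<ge> 0"
  shows "r * integral {0..1} (\<lambda>t. weight c ((1 - t) * r) * weight c (t * r)) \<le> 4 / c * weight c r"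
proof -
  define x where "x = c * r"
  have x: "x \<ge> 0" using assms by (simp add: x_def)
  define h where "h t = x / (1 + x * t)\<^sup>2" for t
  have h: "(h has_integral (1 - 1 / (1 + x))) {0..1}"
    using has_integral_inverse_square[OF x] by (simp add: h_def[abs_def])
  have h': "((\<lambda>t. h (1 - t)) has_integral (1 - 1 / (1 + x))) {0..1}"
    using has_integral_affinity[OF h[folded cbox_interval], of "-1" 1] by (simp add: algebra_simps)
  have bound: "c * r * (weight c ((1 - t) * r) * weight c (t * r))
      \<le> 2 * exp x / (1 + x)\<^sup>2 * (h (1 - t) + h t)" if "t \<in> {0..1}" for t
  proof -
    define a b where "a = 1 + x * (1 - t)" and "b = 1 + x * t"
    have ab: "a > 0" "b > 0" "a + b = 2 + x"
      unfolding a_def b_def using that x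
      by (auto intro!: add_pos_nonneg mult_nonneg_nonneg mult_right_le_one_le simp: right_diff_distrib)
    have "weight c ((1 - t) * r) * weight c (t * r) = exp x * (1 / (a\<^sup>2 * b\<^sup>2))"
      unfolding weight_def a_def b_def x_def
      by (simp add: algebra_simps flip: exp_add)
    also have "1 / (a\<^sup>2 * b\<^sup>2) = ((1 / a + 1 / b) / (a + b))\<^sup>2"
    proof -
      have "(1 / a + 1 / b) / (a + b) = 1 / (a * b)"
        using ab(1,2) add_pos_pos[OF ab(1,2)] by (simp add: divide_simps)
      then show ?thesis by (simp add: power_mult_distrib power_divide)
    qed
    also have "\<dots> \<le> (2 * ((1 / a)\<^sup>2 + (1 / b)\<^sup>2)) / (1 + x)\<^sup>2"
    proof -
      have "(1 / a + 1 / b)\<^sup>2 \<le> 2 * ((1 / a)\<^sup>2 + (1 / b)\<^sup>2)"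
        by (rule sum_squares_bound[THEN order_trans[rotated]] | simp add: power2_sum)
           (use sum_squares_bound[of "1 / a" "1 / b"] in \<open>simp add: power2_sum\<close>)
      moreover have "(1 + x)\<^sup>2 \<le> (a + b)\<^sup>2"
        using x ab by (intro power_mono) auto
      ultimately show ?thesis
        unfolding power_divide using x by (intro frac_le) (auto simp: power_divide)
    qed
    finally have "x * (weight c ((1 - t) * r) * weight c (t * r))
        \<le> x * (exp x * ((2 * ((1 / a)\<^sup>2 + (1 / b)\<^sup>2)) / (1 + x)\<^sup>2))"
      using x by (intro mult_left_mono) auto
    also have "\<dots> = 2 * exp x / (1 + x)\<^sup>2 * (h (1 - t) + h t)"
      by (simp add: h_def a_def b_def power_divide algebra_simps add_divide_distrib)
    finally show ?thesis by (simp add: x_def)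
  qed
  have "c * r * integral {0..1} (\<lambda>t. weight c ((1 - t) * r) * weight c (t * r))
      = integral {0..1} (\<lambda>t. c * r * (weight c ((1 - t) * r) * weight c (t * r)))"
    by simp
  also have "\<dots> \<le> integral {0..1} (\<lambda>t. 2 * exp x / (1 + x)\<^sup>2 * (h (1 - t) + h t))"
  proof (rule integral_le)
    show "(\<lambda>t. c * r * (weight c ((1 - t) * r) * weight c (t * r))) integrable_on {0..1}"
      using assms by (intro integrable_continuous_real continuous_intros continuous_on_weight) auto
    show "(\<lambda>t. 2 * exp x / (1 + x)\<^sup>2 * (h (1 - t) + h t)) integrable_on {0..1}"
      using h h' by (intro integrable_on_mult_right integrable_add) (auto simp: integrable_on_def)
  qed (use bound in auto)
  also have "\<dots> = 2 * exp x / (1 + x)\<^sup>2 * (2 * (1 - 1 / (1 + x)))"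
    by (subst integral_unique[OF has_integral_mult_right[OF has_integral_add[OF h' h]]]) simp
  also have "\<dots> \<le> 2 * exp x / (1 + x)\<^sup>2 * 2"
    using x by (intro mult_left_mono) (auto simp: field_simps)
  finally have "c * (r * integral {0..1} (\<lambda>t. weight c ((1 - t) * r) * weight c (t * r))) \<le> 4 * weight c r"
    by (simp add: weight_def x_def)
  then show ?thesis using assms by (simp add: field_simps)
qed

text \<open>
  The estimate is local: it uses bounds on one segment only. So the constants \<open>A\<close> and \<open>B\<close> may depend on
  \<open>\<zeta>\<close>, which later allows factors such as \<open>norm \<zeta>\<close> that come from multiplication by the variable.
\<close>
lemma norm_conv_le:
  assumes c: "c > 0" and D: "convex D" "0 \<in> D" "\<zeta> \<in> D"
    and cont: "continuous_on D f" "continuous_on D g"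
    and f: "\<And>t. 0 \<le> t \<Longrightarrow> t \<le> 1 \<Longrightarrow> norm (f (t *\<^sub>R \<zeta>)) \<le> A * weight c (t * norm \<zeta>)"
    and g: "\<And>t. 0 \<le> t \<Longrightarrow> t \<le> 1 \<Longrightarrow> norm (g (t *\<^sub>R \<zeta>)) \<le> B * weight c (t * norm \<zeta>)"
    and t: "0 \<le> t" "t \<le> 1"
  shows "norm (conv f g (t *\<^sub>R \<zeta>)) \<le> 4 / c * A * B * weight c (t * norm \<zeta>)"
proof -
  define r where "r = t * norm \<zeta>"
  define \<xi> where "\<xi> = t *\<^sub>R \<zeta>"
  have \<xi>: "\<xi> \<in> D" "norm \<xi> = r" "r \<ge> 0"
    using t scaleR_in_convex[OF D t] by (auto simp: \<xi>_def r_def)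
  have A: "A \<ge> 0" and B: "B \<ge> 0"
    using f[of 0] g[of 0] by (auto simp: weight_def intro: order_trans[OF norm_ge_zero])
  have f': "norm (f (s *\<^sub>R \<xi>)) \<le> A * weight c (s * r)"
    and g': "norm (g (s *\<^sub>R \<xi>)) \<le> B * weight c (s * r)" if "s \<in> {0..1}" for s
    using f[of "s * t"] g[of "s * t"] that t by (auto simp: \<xi>_def r_def mult_le_one mult_ac)
  have "norm (conv f g \<xi>) = r * norm (integral {0..1} (\<lambda>t. f ((1 - t) *\<^sub>R \<xi>) * g (t *\<^sub>R \<xi>)))"
    using \<xi> by (simp add: conv_def norm_mult)
  also have "norm (integral {0..1} (\<lambda>t. f ((1 - t) *\<^sub>R \<xi>) * g (t *\<^sub>R \<xi>)))
     \<le> integral {0..1} (\<lambda>t. A * B * (weight c ((1 - t) * r) * weight c (t * r)))"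
  proof (rule integral_norm_bound_integral)
    show "(\<lambda>t. f ((1 - t) *\<^sub>R \<xi>) * g (t *\<^sub>R \<xi>)) integrable_on {0..1}"
      using \<xi> by (intro integrable_continuous_real conv_integrand_continuous[OF D(1,2)] cont)
    show "(\<lambda>t. A * B * (weight c ((1 - t) * r) * weight c (t * r))) integrable_on {0..1}"
      using c \<xi> by (intro integrable_continuous_real continuous_intros continuous_on_weight) auto
    fix s :: real assume s: "s \<in> {0..1}"
    have "norm (f ((1 - s) *\<^sub>R \<xi>) * g (s *\<^sub>R \<xi>)) \<le> (A * weight c ((1 - s) * r)) * (B * weight c (s * r))"
      unfolding norm_mult using s f'[of "1 - s"] g'[of s] A by (intro mult_mono) (auto simp: weight_nonneg)
    then show "norm (f ((1 - s) *\<^sub>R \<xi>) * g (s *\<^sub>R \<xi>)) \<le> A * B * (weight c ((1 - s) * r) * weight c (s * r))"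
      by (simp add: mult_ac)
  qed
  also have "r * \<dots> = A * B * (r * integral {0..1} (\<lambda>t. weight c ((1 - t) * r) * weight c (t * r)))"
    by (simp add: mult_ac)
  also have "\<dots> \<le> A * B * (4 / c * weight c r)"
    using A B integral_weight_conv_le[OF c \<xi>(3)] by (intro mult_left_mono) auto
  finally have "norm (conv f g \<xi>) \<le> A * B * (4 / c * weight c r)"
    using \<xi>(3) by (simp add: mult_left_mono)
  then show ?thesis by (simp add: \<xi>_def r_def mult_ac)
qed

lemma conv_diff:
  assumes D: "convex D" "0 \<in> D" "\<zeta> \<in> D"
    and cont: "continuous_on D f" "continuous_on D g" "continuous_on D f'" "continuous_on D g'"
  shows "conv f g \<zeta> - conv f' g' \<zeta>
    = conv (\<lambda>x. f x - f' x) g \<zeta> + conv f' (\<lambda>x. g x - g' x) \<zeta>"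
proof -
  have i: "(\<lambda>t. p ((1 - t) *\<^sub>R \<zeta>) * q (t *\<^sub>R \<zeta>)) integrable_on {0..1}"
    if "continuous_on D p" "continuous_on D q" for p q :: "complex \<Rightarrow> complex"
    by (intro integrable_continuous_real conv_integrand_continuous[OF D] that)
  show ?thesis
    unfolding conv_def using i cont
    by (simp add: left_diff_distrib right_diff_distrib Henstock_Kurzweil_Integration.integral_diff
         algebra_simps)
qed

section \<open>Contraction in the convolution algebra\<close>

text \<open>
  Self-mapping and Lipschitz estimates for polynomial convolution operators are obtained
  together, by composing rules for the single operations. The point \<open>\<zeta>\<close> at which the
  operators are compared is fixed, \<open>K\<close> is the radius of the ball in which the fixed point is sought,
  and \<open>d\<close> is the distance of the two arguments. The lower bound \<open>K \<ge> 4\<close> puts the constant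
  function \<open>1\<close> into the ball.
\<close>
locale controlled_pairs =
  fixes D :: "complex set" and c K d :: real and \<zeta> :: complex
  assumes D: "open D" "convex D" "0 \<in> D" "\<zeta> \<in> D"
    and c: "c > 0" and K: "K \<ge> 4" and d: "d \<ge> 0"
begin

text \<open>
  Relative to the ball of radius \<open>K\<close> and to the distance \<open>d\<close>, both functions have size at most \<open>s\<close> and
  their difference has size at most \<open>s\<close>. The single number \<open>s\<close> serves for both purposes; this costs
  a factor \<open>2\<close> in \<open>ctrl_conv\<close>.
\<close>
definition ctrl :: "real \<Rightarrow> (complex \<Rightarrow> complex) \<Rightarrow> (complex \<Rightarrow> complex) \<Rightarrow> bool" where
  "ctrl s f g \<longleftrightarrow> f holomorphic_on D \<and> g holomorphic_on D \<and> s \<ge> 0 \<and>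
     (\<forall>t\<in>{0..1}. norm (f (t *\<^sub>R \<zeta>)) \<le> s * K * weight c (t * norm \<zeta>) \<and>
                 norm (g (t *\<^sub>R \<zeta>)) \<le> s * K * weight c (t * norm \<zeta>) \<and>
                 norm (f (t *\<^sub>R \<zeta>) - g (t *\<^sub>R \<zeta>)) \<le> s * d * weight c (t * norm \<zeta>))"

lemma ctrl_one: "ctrl 1 (\<lambda>_. 1) (\<lambda>_. 1)"
proof -
  have "1 \<le> K * weight c (t * norm \<zeta>)" if "t \<ge> 0" for t
  proof -
    have "1 \<le> 4 * weight c (t * norm \<zeta>)" using weight_ge c that by simp
    also have "\<dots> \<le> K * weight c (t * norm \<zeta>)" using K by (intro mult_right_mono weight_nonneg)
    finally show ?thesis .
  qed
  then show ?thesis using d by (auto simp: ctrl_def weight_nonneg)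
qed

lemma ctrl_mult_ident:
  assumes "ctrl s f g"
  shows "ctrl (norm \<zeta> * s) (\<lambda>x. x * f x) (\<lambda>x. x * g x)"
proof -
  have le: "norm (t *\<^sub>R \<zeta> * y) \<le> norm \<zeta> * s * k * w" if "norm y \<le> s * k * w" "t \<in> {0..1}" for t :: real and y k w
  proof -
    have "norm (t *\<^sub>R \<zeta> * y) = t * (norm \<zeta> * norm y)" using that(2) by (simp add: norm_mult)
    also have "\<dots> \<le> 1 * (norm \<zeta> * (s * k * w))"
      using that by (intro mult_mono) auto
    finally show ?thesis by (simp add: mult_ac)
  qed
  have "norm \<zeta> * s \<ge> 0" using assms by (simp add: ctrl_def)
  moreover have "(\<lambda>x. x * f x) holomorphic_on D" "(\<lambda>x. x * g x) holomorphic_on D"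
    using assms by (auto simp: ctrl_def intro!: holomorphic_intros)
  ultimately show ?thesis
    using assms unfolding ctrl_def right_diff_distrib[symmetric] by (blast intro: le)
qed

lemma ctrl_cmult:
  assumes "ctrl s f g"
  shows "ctrl (norm k * s) (\<lambda>x. k * f x) (\<lambda>x. k * g x)"
  using assms unfolding ctrl_def right_diff_distrib[symmetric] norm_mult
  by (auto intro!: holomorphic_intros simp: mult.assoc intro!: mult_left_mono)

lemma ctrl_add:
  assumes "ctrl s f g" "ctrl s' f' g'"
  shows "ctrl (s + s') (\<lambda>x. f x + f' x) (\<lambda>x. g x + g' x)"
proof -
  have "norm (x + y - (x' + y')) \<le> a + b" if "norm (x - x') \<le> a" "norm (y - y') \<le> b" for x y x' y' :: complex and a b
    using norm_triangle_ineq[of "x - x'" "y - y'"] that by (simp add: algebra_simps)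
  then show ?thesis
    using assms unfolding ctrl_def by (auto intro!: holomorphic_intros norm_triangle_mono simp: distrib_right)
qed

lemma ctrl_mono: "ctrl s f g \<Longrightarrow> s \<le> s' \<Longrightarrow> ctrl s' f g"
proof -
  assume f: "ctrl s f g" and s: "s \<le> s'"
  have "s * k * weight c r \<le> s' * k * weight c r" if "k \<ge> 0" for k r
    using s that by (intro mult_right_mono weight_nonneg) auto
  from this[of K] this[of d] show ?thesis
    using f s K d unfolding ctrl_def by (auto intro: order_trans)
qed

text \<open>
  The small factor \<open>8 K / c\<close> is what makes every nonlinear operator a contraction for large \<open>c\<close>. The
  product rule \<open>f * f' - g * g' = (f - g) * f' + g * (f' - g')\<close> gives the difference bound.
\<close>
lemma ctrl_conv:
  assumes "ctrl s f g" "ctrl s' f' g'"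
  shows "ctrl (8 * K / c * (s * s')) (conv f f') (conv g g')"
proof -
  have h: "f holomorphic_on D" "g holomorphic_on D" "f' holomorphic_on D" "g' holomorphic_on D"
    and s: "s \<ge> 0" "s' \<ge> 0"
    using assms by (auto simp: ctrl_def)
  note cn = h[THEN holomorphic_on_imp_continuous_on]
  have cd: "continuous_on D (\<lambda>x. f x - g x)" "continuous_on D (\<lambda>x. f' x - g' x)"
    by (auto intro!: continuous_intros cn)
  have m: "4 / c * (s * K) * (s' * K) * w \<le> 8 * K / c * (s * s') * K * w" if "w \<ge> 0" for w
    using c K s that by (simp add: mult_ac divide_right_mono mult_left_mono)
  {
    fix t :: real assume t: "0 \<le> t" "t \<le> 1"
    note b = norm_conv_le[OF c D(2,3,4) _ _ _ _ t]
    have "norm (conv f f' (t *\<^sub>R \<zeta>)) \<le> 4 / c * (s * K) * (s' * K) * weight c (t * norm \<zeta>)"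
      by (rule b) (use cn assms in \<open>auto simp: ctrl_def\<close>)
    moreover have "norm (conv g g' (t *\<^sub>R \<zeta>)) \<le> 4 / c * (s * K) * (s' * K) * weight c (t * norm \<zeta>)"
      by (rule b) (use cn assms in \<open>auto simp: ctrl_def\<close>)
    moreover have "norm (conv f f' (t *\<^sub>R \<zeta>) - conv g g' (t *\<^sub>R \<zeta>))
        \<le> 8 * K / c * (s * s') * d * weight c (t * norm \<zeta>)"
    proof -
      have "norm (conv (\<lambda>x. f x - g x) f' (t *\<^sub>R \<zeta>)) \<le> 4 / c * (s * d) * (s' * K) * weight c (t * norm \<zeta>)"
        by (rule b) (use cn cd assms in \<open>auto simp: ctrl_def\<close>)
      moreover have "norm (conv g (\<lambda>x. f' x - g' x) (t *\<^sub>R \<zeta>)) \<le> 4 / c * (s * K) * (s' * d) * weight c (t * norm \<zeta>)"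
        by (rule b) (use cn cd assms in \<open>auto simp: ctrl_def\<close>)
      ultimately have "norm (conv f f' (t *\<^sub>R \<zeta>) - conv g g' (t *\<^sub>R \<zeta>)) \<le>
        4 / c * (s * d) * (s' * K) * weight c (t * norm \<zeta>) + 4 / c * (s * K) * (s' * d) * weight c (t * norm \<zeta>)"
        using conv_diff[OF D(2,3) scaleR_in_convex[OF D(2-4) t] cn(1,3,2,4)]
        by (metis norm_triangle_mono)
      also have "\<dots> = 8 * K / c * (s * s') * d * weight c (t * norm \<zeta>)"
        by (simp add: field_simps)
      finally show ?thesis .
    qed
    ultimately have "norm (conv f f' (t *\<^sub>R \<zeta>)) \<le> 8 * K / c * (s * s') * K * weight c (t * norm \<zeta>)"
      "norm (conv g g' (t *\<^sub>R \<zeta>)) \<le> 8 * K / c * (s * s') * K * weight c (t * norm \<zeta>)"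
      "norm (conv f f' (t *\<^sub>R \<zeta>) - conv g g' (t *\<^sub>R \<zeta>))
        \<le> 8 * K / c * (s * s') * d * weight c (t * norm \<zeta>)"
      using m[OF weight_nonneg] by (meson order_trans)+
  }
  moreover have "8 * K / c * (s * s') \<ge> 0" using s c K by simp
  ultimately show ?thesis
    unfolding ctrl_def using holomorphic_conv[OF D(1-3)] h by auto
qed

end

text \<open>
  Banach's fixed point theorem for holomorphic functions in a weighted ball. The weight is locally
  bounded, so the iterates converge locally uniformly and their limit is holomorphic.
\<close>
lemma contraction_fixed_point:
  fixes \<Phi> :: "(complex \<Rightarrow> complex) \<Rightarrow> complex \<Rightarrow> complex" and m :: "complex \<Rightarrow> real"
  assumes D: "open D" and K: "K \<ge> 0" and m: "continuous_on D m" "\<And>x. m x \<ge> 0"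
  defines "X \<equiv> {f. f holomorphic_on D \<and> (\<forall>x\<in>D. norm (f x) \<le> K * m x)}"
  assumes self: "\<And>f. f \<in> X \<Longrightarrow> \<Phi> f \<in> X"
    and contr: "\<And>f g d. f \<in> X \<Longrightarrow> g \<in> X \<Longrightarrow> d \<ge> 0 \<Longrightarrow> (\<And>x. x \<in> D \<Longrightarrow> norm (f x - g x) \<le> d * m x)
        \<Longrightarrow> (\<And>x. x \<in> D \<Longrightarrow> norm (\<Phi> f x - \<Phi> g x) \<le> d / 2 * m x)"
  obtains f where "f \<in> X" "\<And>x. x \<in> D \<Longrightarrow> \<Phi> f x = f x"
proof -
  define h where "h n = (\<Phi> ^^ n) (\<lambda>_. 0)" for n
  have hS: "h (Suc n) = \<Phi> (h n)" for n by (simp add: h_def)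
  have hX: "h n \<in> X" for n
  proof (induction n)
    case 0
    then show ?case using K m by (auto simp: h_def X_def)
  qed (simp add: hS self)
  have step: "norm (h (Suc n) x - h n x) \<le> K * m x * (1 / 2) ^ n" if "x \<in> D" for n x
    using that
  proof (induction n arbitrary: x)
    case 0
    then show ?case using hX[of 1] by (simp add: X_def h_def)
  next
    case (Suc n)
    have IH: "norm (h (Suc n) y - h n y) \<le> (K * (1 / 2) ^ n) * m y" if "y \<in> D" for y
      using Suc.IH[OF that] by (simp add: mult_ac)
    have "norm (h (Suc (Suc n)) x - h (Suc n) x) \<le> (K * (1 / 2) ^ n) / 2 * m x"
      unfolding hS[of "Suc n"] using contr[OF hX hX _ IH] K Suc.prems by (simp add: hS)
    then show ?case by (simp add: mult_ac)
  qed
  define f where "f x = (\<Sum>i. h (Suc i) x - h i x)" for x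
  have tele: "(\<Sum>i<n. h (Suc i) x - h i x) = h n x" for n x
    by (induction n) (auto simp: h_def)
  have summ: "summable (\<lambda>i. h (Suc i) x - h i x)" if "x \<in> D" for x
    by (rule summable_comparison_test'[where g="\<lambda>i. K * m x * (1 / 2) ^ i" and N=0])
       (use step[OF that] in \<open>auto intro!: summable_mult summable_geometric\<close>)
  have lim: "(\<lambda>n. h n x) \<longlonglongrightarrow> f x" if "x \<in> D" for x
    using summable_LIMSEQ[OF summ[OF that]] by (simp add: tele f_def)
  \<comment> \<open>The geometric bound on the tail is needed to pass to the limit in the fixed point equation.\<close>
  have tail: "norm (f x - h n x) \<le> 2 * K * (1 / 2) ^ n * m x" if "x \<in> D" for n x
  proof -
    have "f x - h n x = (\<Sum>i. h (Suc (i + n)) x - h (i + n) x)"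
      using suminf_minus_initial_segment[OF summ[OF that], of n] by (simp add: tele f_def)
    also have "norm \<dots> \<le> (\<Sum>i. K * m x * (1 / 2) ^ n * (1 / 2) ^ i)"
      by (rule norm_suminf_le) (use step[OF that, of "_ + n"] in \<open>auto simp: power_add mult_ac intro!: summable_mult summable_mult2 summable_geometric\<close>)
    also have "\<dots> = K * m x * (1 / 2) ^ n * 2"
      by (subst suminf_mult) (auto simp: suminf_geometric summable_geometric)
    finally show ?thesis by (simp add: mult_ac)
  qed
  have "f holomorphic_on D"
  proof (rule holomorphic_uniform_sequence[OF D])
    show "h n holomorphic_on D" for n using hX by (simp add: X_def)
    fix x assume "x \<in> D"
    then obtain r where r: "r > 0" "cball x r \<subseteq> D" using D open_contains_cball by blast
    obtain M where M: "\<And>y. y \<in> cball x r \<Longrightarrow> m y \<le> M"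
      using continuous_attains_sup[of "cball x r" m] r continuous_on_subset[OF m(1) r(2)]
      by (metis cball_eq_empty compact_cball not_less_iff_gr_or_eq)
    have "uniform_limit (cball x r) (\<lambda>n y. \<Sum>i<n. h (Suc i) y - h i y) (\<lambda>y. \<Sum>i. h (Suc i) y - h i y) sequentially"
    proof (rule Weierstrass_m_test)
      fix n y assume y: "y \<in> cball x r"
      then have "norm (h (Suc n) y - h n y) \<le> K * m y * (1 / 2) ^ n" using r step by blast
      also have "\<dots> \<le> K * M * (1 / 2) ^ n" using M[OF y] K by (intro mult_right_mono mult_left_mono) auto
      finally show "norm (h (Suc n) y - h n y) \<le> K * M * (1 / 2) ^ n" .
    qed (auto intro!: summable_mult summable_geometric)
    then have "uniform_limit (cball x r) h f sequentially"
      by (simp add: tele f_def[abs_def])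
    then show "\<exists>r>0. cball x r \<subseteq> D \<and> uniform_limit (cball x r) h f sequentially"
      using r by blast
  qed
  moreover have "norm (f x) \<le> K * m x" if "x \<in> D" for x
    using hX that by (intro LIMSEQ_le_const2[OF tendsto_norm[OF lim[OF that]]]) (auto simp: X_def)
  ultimately have fX: "f \<in> X" by (simp add: X_def)
  moreover have "\<Phi> f x = f x" if x: "x \<in> D" for x
  proof -
    have b: "norm (\<Phi> f x - f x) \<le> 2 * K * m x * (1 / 2) ^ n" for n
    proof -
      have "norm (\<Phi> f x - h (Suc n) x) \<le> (2 * K * (1 / 2) ^ n) / 2 * m x"
        using contr[OF fX hX, of "2 * K * (1 / 2) ^ n" n x] tail K x by (simp add: hS)
      moreover have "norm (f x - h (Suc n) x) \<le> K * (1 / 2) ^ n * m x" using tail[OF x, of "Suc n"] by simp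
      ultimately have "norm ((\<Phi> f x - h (Suc n) x) - (f x - h (Suc n) x)) \<le>
         (2 * K * (1 / 2) ^ n) / 2 * m x + K * (1 / 2) ^ n * m x"
        by (rule order_trans[OF norm_triangle_ineq4 add_mono])
      also have "\<dots> = 2 * K * m x * (1 / 2) ^ n" by simp
      finally show ?thesis by simp
    qed
    have "(\<lambda>n. 2 * K * m x * (1 / 2) ^ n) \<longlonglongrightarrow> 2 * K * m x * 0"
      by (intro tendsto_intros LIMSEQ_power_zero) auto
    then have "norm (\<Phi> f x - f x) \<le> 2 * K * m x * 0"
      by (rule LIMSEQ_le_const) (use b in auto)
    then show ?thesis by simp
  qed
  ultimately show ?thesis using that by blast
qed

section \<open>The Laplace transform along a ray\<close>

lemma has_bochner_integral_exp_decay: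
  fixes a :: real
  assumes "a > 0"
  shows "has_bochner_integral lborel (\<lambda>t. indicator {0..} t *\<^sub>R exp (- (a * t))) (1 / a)"
proof (rule has_bochner_integral_nn_integral)
  have "((\<lambda>t. - (exp (- (a * t)) / a)) \<longlongrightarrow> - (0 / a)) at_top"
    using assms by (intro tendsto_intros filterlim_compose[OF exp_at_bot]
        filterlim_compose[OF filterlim_uminus_at_bot_at_top] filterlim_tendsto_pos_mult_at_top[OF tendsto_const]
        filterlim_ident) auto
  then have "(\<integral>\<^sup>+t. ennreal (exp (- (a * t))) * indicator {0..} t \<partial>lborel) = ennreal (0 - (- (exp (- (a * 0)) / a)))"
    using assms by (intro nn_integral_FTC_atLeast) (auto intro!: derivative_eq_intros)
  moreover have "(\<integral>\<^sup>+t. ennreal (indicator {0..} t *\<^sub>R exp (- (a * t))) \<partial>lborel) =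
      (\<integral>\<^sup>+t. ennreal (exp (- (a * t))) * indicator {0..} t \<partial>lborel)"
    by (intro nn_integral_cong) (auto simp: indicator_def)
  ultimately show "(\<integral>\<^sup>+t. ennreal (indicator {0..} t *\<^sub>R exp (- (a * t))) \<partial>lborel) = ennreal (1 / a)"
    by simp
qed (use assms in auto)

lemma norm_exp_remainder_le: "norm (exp w - 1 - w) \<le> (norm w)\<^sup>2 * exp (norm w)" for w :: complex
proof -
  have "norm (exp w - (\<Sum>k\<le>1. w ^ k / fact k)) \<le> exp \<bar>Re w\<bar> * norm w ^ Suc 1 / fact 1"
    by (rule Taylor_exp)
  also have "\<dots> \<le> exp (norm w) * norm w ^ Suc 1 / fact 1"
    using abs_Re_le_cmod[of w] by (intro divide_right_mono mult_right_mono) auto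
  finally show ?thesis by (simp add: power2_eq_square mult_ac diff_diff_eq)
qed

lemma power2_le_exp: "t\<^sup>2 \<le> 2 / \<delta>\<^sup>2 * exp (\<delta> * t)" if "\<delta> > 0" "t \<ge> 0" for t \<delta> :: real
proof -
  have "(\<delta> * t)\<^sup>2 / 2 \<le> exp (\<delta> * t)"
    using exp_lower_Taylor_quadratic[of "\<delta> * t"] mult_nonneg_nonneg[of \<delta> t] that by linarith
  then show ?thesis using that by (simp add: field_simps)
qed

text \<open>
  The ray has the direction \<open>e\<close>, and the transform converges in half-planes \<open>Re (z * e) > c\<close>. Convexity of
  the domain makes it star-shaped about the origin of the ray, as convolutions require.
\<close>
locale laplace_ray =
  fixes D :: "complex set" and e :: complex
  assumes D: "open D" "convex D" and norm_e: "norm e = 1"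
    and ray: "\<And>t. t \<ge> 0 \<Longrightarrow> t *\<^sub>R e \<in> D"
begin

definition lap_integrand :: "(complex \<Rightarrow> complex) \<Rightarrow> complex \<Rightarrow> real \<Rightarrow> complex" where
  "lap_integrand f z t = indicator {0..} t *\<^sub>R (exp (- (z * (t *\<^sub>R e))) * (e * f (t *\<^sub>R e)))"

text \<open>
  The relational form carries convergence along with the value, so that the transform of a compound
  expression is found by composing rules.
\<close>
definition has_lap :: "(complex \<Rightarrow> complex) \<Rightarrow> complex \<Rightarrow> complex \<Rightarrow> bool" where
  "has_lap f z v \<longleftrightarrow> has_bochner_integral lborel (lap_integrand f z) v"

definition lap :: "(complex \<Rightarrow> complex) \<Rightarrow> complex \<Rightarrow> complex" where
  "lap f z = integral\<^sup>L lborel (lap_integrand f z)"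

lemma has_lap_unique: "has_lap f z v \<Longrightarrow> has_lap f z v' \<Longrightarrow> v = v'"
  unfolding has_lap_def by (rule has_bochner_integral_eq)

lemma has_lap_imp_lap: "has_lap f z v \<Longrightarrow> lap f z = v"
  unfolding has_lap_def lap_def by (rule has_bochner_integral_integral_eq)

lemma has_lap_add: "has_lap f z v \<Longrightarrow> has_lap g z v' \<Longrightarrow> has_lap (\<lambda>x. f x + g x) z (v + v')"
  unfolding has_lap_def
  by (drule (1) has_bochner_integral_add) (simp add: lap_integrand_def[abs_def] algebra_simps)

lemma has_lap_cmult: "has_lap f z v \<Longrightarrow> has_lap (\<lambda>x. k * f x) z (k * v)"
  unfolding has_lap_def
  using has_bochner_integral_mult_right[of k lborel "lap_integrand f z" v] by (simp add: lap_integrand_def[abs_def] mult_ac)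

lemma has_lap_cong: "has_lap f z v \<Longrightarrow> (\<And>x. x \<in> D \<Longrightarrow> f x = g x) \<Longrightarrow> has_lap g z v"
proof -
  assume "has_lap f z v" and fg: "\<And>x. x \<in> D \<Longrightarrow> f x = g x"
  moreover have "lap_integrand f z = lap_integrand g z"
    using fg ray by (auto simp: lap_integrand_def fun_eq_iff indicator_def)
  ultimately show ?thesis by (simp add: has_lap_def)
qed

lemma continuous_on_ray:
  assumes "f holomorphic_on D"
  shows "continuous_on {0..} (\<lambda>t::real. f (t *\<^sub>R e))"
  by (rule continuous_on_compose2[OF holomorphic_on_imp_continuous_on[OF assms]])
     (auto intro!: continuous_intros ray)

lemma lap_integrand_measurable:
  assumes "f holomorphic_on D"
  shows "lap_integrand f z \<in> borel_measurable borel"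
  unfolding lap_integrand_def[abs_def]
  by (intro borel_measurable_continuous_on_indicator continuous_intros continuous_on_ray assms) simp

lemma has_lap_bounded:
  assumes f: "f holomorphic_on D" and b: "\<And>t. t \<ge> 0 \<Longrightarrow> norm (f (t *\<^sub>R e)) \<le> K * exp (c * t)"
    and z: "c < Re (z * e)"
  shows "has_lap f z (lap f z)" "norm (lap f z) \<le> K / (Re (z * e) - c)"
proof -
  define a where "a = Re (z * e) - c"
  have a: "a > 0" using z by (simp add: a_def)
  have i: "has_bochner_integral lborel (\<lambda>t. K * (indicator {0..} t *\<^sub>R exp (- (a * t)))) (K * (1 / a))"
    by (intro has_bochner_integral_mult_right has_bochner_integral_exp_decay a)
  have le: "norm (lap_integrand f z t) \<le> K * (indicator {0..} t *\<^sub>R exp (- (a * t)))" for t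
  proof (cases "t \<ge> 0")
    case True
    have "norm (lap_integrand f z t) = exp (- (t * Re (z * e))) * norm (f (t *\<^sub>R e))"
      using True by (simp add: lap_integrand_def norm_mult norm_e)
    also have "\<dots> \<le> exp (- (t * Re (z * e))) * (K * exp (c * t))"
      using b[OF True] by (intro mult_left_mono) auto
    also have "\<dots> = K * exp (- (a * t))"
      by (simp add: a_def algebra_simps flip: exp_add)
    finally show ?thesis using True by simp
  qed (simp add: lap_integrand_def)
  have int: "integrable lborel (lap_integrand f z)"
  proof (rule Bochner_Integration.integrable_bound[OF integrable.intros[OF i]])
    show "lap_integrand f z \<in> borel_measurable lborel"
      using lap_integrand_measurable[OF f] by simp
    have "norm (lap_integrand f z t) \<le> norm (K * (indicator {0..} t *\<^sub>R exp (- (a * t))))" for t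
      using le[of t] unfolding real_norm_def by linarith
    then show "AE t in lborel. norm (lap_integrand f z t) \<le> norm (K * (indicator {0..} t *\<^sub>R exp (- (a * t))))"
      by (rule AE_I2)
  qed
  then show "has_lap f z (lap f z)"
    by (simp add: has_lap_def lap_def has_bochner_integral_integrable)
  have "norm (lap f z) \<le> (\<integral>t. K * (indicator {0..} t *\<^sub>R exp (- (a * t))) \<partial>lborel)"
    unfolding lap_def by (rule Bochner_Integration.integral_norm_bound_integral[OF int integrable.intros[OF i]]) (use le in auto)
  also have "\<dots> = K / a" using has_bochner_integral_integral_eq[OF i] by simp
  finally show "norm (lap f z) \<le> K / (Re (z * e) - c)" by (simp add: a_def)
qed

text \<open>
  Extended by zero to the whole line, the integrand of the convolution is the usual convolution of the
  two integrands, because \<open>exp (- z t e) = exp (- z (t - s) e) exp (- z s e)\<close>. Fubini's theorem and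
  translation invariance give the product.
\<close>
lemma has_lap_conv:
  assumes f: "f holomorphic_on D" and g: "g holomorphic_on D"
    and "has_lap f z v" "has_lap g z w"
  shows "has_lap (conv f g) z (v * w)"
proof -
  define F where "F = lap_integrand f z"
  define G where "G = lap_integrand g z"
  have F: "integrable lborel F" "integral\<^sup>L lborel F = v" and G: "integrable lborel G" "integral\<^sup>L lborel G = w"
    using assms by (auto simp: has_lap_def F_def G_def has_bochner_integral_iff)
  have [measurable]: "F \<in> borel_measurable borel" "G \<in> borel_measurable borel"
    using lap_integrand_measurable f g by (auto simp: F_def G_def)
  have sh: "integrable lborel (\<lambda>t. F (t - s))" "(\<integral>t. F (t - s) \<partial>lborel) = v" for s
    using lborel_integrable_real_affine[OF F(1), of 1 "-s"] lborel_integral_real_affine[of 1 F "-s"] F(2)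
    by simp_all
  have shn: "(\<integral>t. norm (F (t - s)) \<partial>lborel) = (\<integral>t. norm (F t) \<partial>lborel)" for s
    using lborel_integral_real_affine[of 1 "\<lambda>t. norm (F t)" "-s"] by simp
  have int: "integrable (lborel \<Otimes>\<^sub>M lborel) (\<lambda>(s, t). F (t - s) * G s)"
  proof (rule lborel_pair.Fubini_integrable)
    show "(\<lambda>(s, t). F (t - s) * G s) \<in> borel_measurable (lborel \<Otimes>\<^sub>M lborel)"
      by measurable
    show "integrable lborel (\<lambda>s. \<integral>t. norm (case (s, t) of (s, t) \<Rightarrow> F (t - s) * G s) \<partial>lborel)"
      using G(1) by (simp add: norm_mult shn integrable_norm)
    show "AE s in lborel. integrable lborel (\<lambda>t. case (s, t) of (s, t) \<Rightarrow> F (t - s) * G s)"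
      using sh by simp
  qed
  \<comment> \<open>The substitution \<open>s = t \<tau>\<close> degenerates at \<open>t = 0\<close>, a null set.\<close>
  have eq: "(\<integral>s. F (t - s) * G s \<partial>lborel) = lap_integrand (conv f g) z t" if "t \<noteq> 0" for t
  proof (cases "t > 0")
    case True
    have cont: "continuous_on {0..1} (\<lambda>\<tau>. f ((1 - \<tau>) *\<^sub>R t *\<^sub>R e) * g (\<tau> *\<^sub>R t *\<^sub>R e))"
      using True ray[of 0] f g by (intro conv_integrand_continuous[OF D(2)] ray holomorphic_on_imp_continuous_on) auto
    have "(\<integral>s. F (t - s) * G s \<partial>lborel) = t *\<^sub>R (\<integral>\<tau>. F (t - t * \<tau>) * G (t * \<tau>) \<partial>lborel)"
      using lborel_integral_real_affine[of t "\<lambda>s. F (t - s) * G s" 0] True by simp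
    also have "(\<lambda>\<tau>. F (t - t * \<tau>) * G (t * \<tau>)) =
       (\<lambda>\<tau>. (exp (- (z * (t *\<^sub>R e))) * e\<^sup>2) * (indicator {0..1} \<tau> *\<^sub>R (f ((1 - \<tau>) *\<^sub>R t *\<^sub>R e) * g (\<tau> *\<^sub>R t *\<^sub>R e))))"
    proof
      fix \<tau>
      have "t - t * \<tau> \<ge> 0 \<longleftrightarrow> \<tau> \<le> 1" "t * \<tau> \<ge> 0 \<longleftrightarrow> \<tau> \<ge> 0"
        using True by (auto simp: mult_le_cancel_left1 zero_le_mult_iff)
      moreover have "exp (- (z * (t *\<^sub>R e))) = exp (- (z * ((t - t * \<tau>) *\<^sub>R e))) * exp (- (z * ((t * \<tau>) *\<^sub>R e)))"
        by (simp add: scaleR_conv_of_real algebra_simps flip: exp_add)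
      ultimately show "F (t - t * \<tau>) * G (t * \<tau>) = (exp (- (z * (t *\<^sub>R e))) * e\<^sup>2) * (indicator {0..1} \<tau> *\<^sub>R (f ((1 - \<tau>) *\<^sub>R t *\<^sub>R e) * g (\<tau> *\<^sub>R t *\<^sub>R e)))"
        by (simp add: F_def G_def lap_integrand_def indicator_def power2_eq_square algebra_simps)
    qed
    also have "(\<integral>\<tau>. (exp (- (z * (t *\<^sub>R e))) * e\<^sup>2) * (indicator {0..1} \<tau> *\<^sub>R (f ((1 - \<tau>) *\<^sub>R t *\<^sub>R e) * g (\<tau> *\<^sub>R t *\<^sub>R e))) \<partial>lborel)
      = (exp (- (z * (t *\<^sub>R e))) * e\<^sup>2) * (LINT \<tau>:{0..1}|lborel. f ((1 - \<tau>) *\<^sub>R t *\<^sub>R e) * g (\<tau> *\<^sub>R t *\<^sub>R e))"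
      unfolding set_lebesgue_integral_def by (rule integral_mult_right_zero)
    also have "(LINT \<tau>:{0..1}|lborel. f ((1 - \<tau>) *\<^sub>R t *\<^sub>R e) * g (\<tau> *\<^sub>R t *\<^sub>R e))
       = integral {0..1} (\<lambda>\<tau>. f ((1 - \<tau>) *\<^sub>R t *\<^sub>R e) * g (\<tau> *\<^sub>R t *\<^sub>R e))"
      by (rule set_borel_integral_eq_integral(2)[OF borel_integrable_atLeastAtMost'[OF cont]])
    finally show ?thesis using True
      by (simp add: lap_integrand_def conv_def scaleR_conv_of_real power2_eq_square mult_ac)
  next
    case False
    then have "(\<lambda>s. F (t - s) * G s) = (\<lambda>_. 0)"
      using that by (auto simp: F_def G_def lap_integrand_def indicator_def)
    then show ?thesis using False that by (simp add: lap_integrand_def)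
  qed
  have ae: "AE t in lborel. (\<integral>s. F (t - s) * G s \<partial>lborel) = lap_integrand (conv f g) z t"
    using AE_lborel_singleton[of "0::real"] by eventually_elim (simp add: eq)
  have "integrable lborel (\<lambda>t. \<integral>s. F (t - s) * G s \<partial>lborel)"
    using lborel_pair.integrable_fst'[OF lborel_pair.integrable_product_swap[OF int]] by simp
  moreover have "(\<integral>t. (\<integral>s. F (t - s) * G s \<partial>lborel) \<partial>lborel) = (\<integral>s. (\<integral>t. F (t - s) * G s \<partial>lborel) \<partial>lborel)"
    using lborel_pair.Fubini_integral[of "\<lambda>s t. F (t - s) * G s"] int by simp
  moreover have "\<dots> = v * w"
    using sh(2) G(2) by simp
  ultimately have "has_bochner_integral lborel (\<lambda>t. \<integral>s. F (t - s) * G s \<partial>lborel) (v * w)"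
    by (simp add: has_bochner_integral_iff)
  moreover have "(\<lambda>t. \<integral>s. F (t - s) * G s \<partial>lborel) \<in> borel_measurable lborel"
    by measurable
  moreover have "lap_integrand (conv f g) z \<in> borel_measurable lborel"
    using lap_integrand_measurable[OF holomorphic_conv[OF D _ f g]] ray[of 0] by simp
  ultimately show ?thesis
    unfolding has_lap_def using has_bochner_integral_cong_AE ae by blast
qed

text \<open>
  The remainder of the difference quotient is itself a Laplace transform at \<open>z\<close>, that of
  \<open>(exp (- h x) - 1 + h x) f x\<close>. This function is bounded by \<open>(norm h)\<^sup>2\<close> times an
  exponential with a slightly larger rate, so the remainder is of second order in \<open>h\<close>.
\<close>
lemma has_field_derivative_lap:
  assumes f: "f holomorphic_on D" and b: "\<And>t. t \<ge> 0 \<Longrightarrow> norm (f (t *\<^sub>R e)) \<le> K * exp (c * t)"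
    and z: "c < Re (z * e)"
  shows "(lap f has_field_derivative lap (\<lambda>x. - (x * f x)) z) (at z)"
proof -
  \<comment> \<open>One third of the gap absorbs \<open>norm h\<close>, one third the factor \<open>t\<^sup>2\<close>, and one third ensures convergence.\<close>
  define \<delta> where "\<delta> = (Re (z * e) - c) / 3"
  have \<delta>: "\<delta> > 0" "Re (z * e) = c + 3 * \<delta>" using z by (auto simp: \<delta>_def field_simps)
  have K: "K \<ge> 0" using b[of 0] order_trans[OF norm_ge_zero] by fastforce
  define M where "M = K * (2 / \<delta>\<^sup>2) / \<delta>"
  have main: "norm (lap f (z + h) - lap f z - h * lap (\<lambda>x. - (x * f x)) z) \<le> M * (norm h)\<^sup>2"
    if h: "norm h \<le> \<delta>" for h
  proof -
    define g where "g x = (exp (- (h * x)) - 1 - (- (h * x))) * f x" for x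
    have ghol: "g holomorphic_on D" unfolding g_def by (intro holomorphic_intros f)
    have gb: "norm (g (t *\<^sub>R e)) \<le> K * (2 / \<delta>\<^sup>2) * (norm h)\<^sup>2 * exp ((c + 2 * \<delta>) * t)" if t: "t \<ge> 0" for t
    proof -
      have nh: "norm (- (h * (t *\<^sub>R e))) = norm h * t" using t by (simp add: norm_mult norm_e)
      have "norm (g (t *\<^sub>R e)) \<le> ((norm h * t)\<^sup>2 * exp (norm h * t)) * (K * exp (c * t))"
        unfolding g_def norm_mult
        using norm_exp_remainder_le[of "- (h * (t *\<^sub>R e))"] b[OF t] unfolding nh by (intro mult_mono) auto
      also have "\<dots> \<le> (((norm h)\<^sup>2 * (2 / \<delta>\<^sup>2 * exp (\<delta> * t))) * exp (\<delta> * t)) * (K * exp (c * t))"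
        using K t h \<delta>(1) power2_le_exp[OF \<delta>(1) t]
        by (simp only: power_mult_distrib, intro mult_right_mono mult_mono mult_left_mono)
           (auto intro!: mult_right_mono)
      also have "\<dots> = K * (2 / \<delta>\<^sup>2) * (norm h)\<^sup>2 * exp ((c + 2 * \<delta>) * t)"
      proof -
        have "exp ((c + 2 * \<delta>) * t) = exp (\<delta> * t) * exp (\<delta> * t) * exp (c * t)"
          by (simp add: algebra_simps flip: exp_add)
        then show ?thesis by simp
      qed
      finally show ?thesis .
    qed
    have fz: "has_lap f z (lap f z)"
      by (rule has_lap_bounded(1)[OF f b z])
    have xb: "norm (- (t *\<^sub>R e * f (t *\<^sub>R e))) \<le> K / \<delta> * exp ((c + \<delta>) * t)" if t: "t \<ge> 0" for t
    proof -
      have "t \<le> exp (\<delta> * t) / \<delta>"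
      proof -
        have "\<delta> * t \<le> exp (\<delta> * t)"
          using exp_ge_add_one_self[of "\<delta> * t"] by linarith
        then show ?thesis using \<delta>(1) by (simp add: field_simps)
      qed
      then have "norm (- (t *\<^sub>R e * f (t *\<^sub>R e))) \<le> exp (\<delta> * t) / \<delta> * (K * exp (c * t))"
        using mult_mono[OF _ b[OF t], of t "exp (\<delta> * t) / \<delta>"] t \<delta>(1) by (simp add: norm_mult norm_e)
      then show ?thesis by (simp add: algebra_simps exp_add)
    qed
    have xz: "has_lap (\<lambda>x. - (x * f x)) z (lap (\<lambda>x. - (x * f x)) z)"
      by (rule has_lap_bounded(1)[OF _ xb]) (use f \<delta> in \<open>auto intro!: holomorphic_intros\<close>)
    have gz: "has_lap g z (lap g z)" "norm (lap g z) \<le> K * (2 / \<delta>\<^sup>2) * (norm h)\<^sup>2 / \<delta>"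
      using has_lap_bounded[OF ghol gb, of z] \<delta> by auto
    have "has_lap f (z + h) (lap g z + (lap f z + h * lap (\<lambda>x. - (x * f x)) z))"
    proof -
      have "lap_integrand f (z + h) = lap_integrand (\<lambda>x. g x + (f x + h * (- (x * f x)))) z"
      proof
        fix t
        have E: "exp (- ((z + h) * y)) = exp (- (z * y)) * exp (- (h * y))" for y
          by (simp add: algebra_simps flip: exp_add)
        then show "lap_integrand f (z + h) t = lap_integrand (\<lambda>x. g x + (f x + h * (- (x * f x)))) z t"
          unfolding lap_integrand_def g_def E by (simp add: algebra_simps)
      qed
      then show ?thesis
        using has_lap_add[OF gz(1) has_lap_add[OF fz has_lap_cmult[OF xz, of h]]]
        by (simp add: has_lap_def)
    qed
    then show ?thesis using gz(2) has_lap_imp_lap by (simp add: M_def mult_ac)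
  qed
  show ?thesis
    unfolding DERIV_def
  proof (rule LIM_zero_cancel)
    have "((\<lambda>h::complex. M * norm h) \<longlongrightarrow> 0) (at 0)"
      by (intro tendsto_mult_right_zero tendsto_norm_zero tendsto_ident_at)
    then show "((\<lambda>h. (lap f (z + h) - lap f z) / h - lap (\<lambda>x. - (x * f x)) z) \<longlongrightarrow> 0) (at 0)"
    proof (rule Lim_null_comparison[rotated])
      show "\<forall>\<^sub>F h in at 0. norm ((lap f (z + h) - lap f z) / h - lap (\<lambda>x. - (x * f x)) z) \<le> M * norm h"
        unfolding eventually_at
      proof (intro exI[of _ \<delta>] conjI \<delta> ballI impI)
        fix h :: complex assume "h \<in> UNIV" "h \<noteq> 0 \<and> dist h 0 < \<delta>"
        then have h: "h \<noteq> 0" "norm h \<le> \<delta>" by auto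
        have "(lap f (z + h) - lap f z) / h - lap (\<lambda>x. - (x * f x)) z
            = (lap f (z + h) - lap f z - h * lap (\<lambda>x. - (x * f x)) z) / h"
          using h by (simp add: field_simps)
        then have "norm ((lap f (z + h) - lap f z) / h - lap (\<lambda>x. - (x * f x)) z) \<le> M * (norm h)\<^sup>2 / norm h"
          using main[OF h(2)] by (simp add: norm_divide divide_right_mono)
        then show "norm ((lap f (z + h) - lap f z) / h - lap (\<lambda>x. - (x * f x)) z) \<le> M * norm h"
          using h by (simp add: power2_eq_square)
      qed
    qed
  qed
qed

text \<open>
  Partial integration; the boundary term at infinity vanishes in the half-plane of convergence.
\<close>
lemma lap_deriv:
  assumes f: "f holomorphic_on D" and b: "\<And>t. t \<ge> 0 \<Longrightarrow> norm (f (t *\<^sub>R e)) \<le> K * exp (c * t)"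
    and b': "\<And>t. t \<ge> 0 \<Longrightarrow> norm (deriv f (t *\<^sub>R e)) \<le> K' * exp (c * t)"
    and z: "c < Re (z * e)"
  shows "lap (deriv f) z = z * lap f z - f 0"
proof -
  have f': "deriv f holomorphic_on D" using f D by (intro holomorphic_deriv)
  have l: "has_lap f z (lap f z)" "has_lap (deriv f) z (lap (deriv f) z)"
    using has_lap_bounded(1) f f' b b' z by blast+
  define F where "F t = exp (- (z * (t *\<^sub>R e))) * f (t *\<^sub>R e)" for t
  define F' where "F' t = exp (- (z * (t *\<^sub>R e))) * (e * (deriv f (t *\<^sub>R e) + (- z) * f (t *\<^sub>R e)))" for t
  have L: "has_bochner_integral lborel (\<lambda>t. indicator {0..} t *\<^sub>R F' t) (lap (deriv f) z + (- z) * lap f z)"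
    using has_lap_add[OF l(2) has_lap_cmult[OF l(1), of "-z"]]
    by (simp add: has_lap_def lap_integrand_def[abs_def] F'_def)
  have ae: "AE t in lborel. indicator {0..} t *\<^sub>R F' t = indicator {0<..} t *\<^sub>R F' t"
    using AE_lborel_singleton[of "0::real"] by eventually_elim (auto simp: indicator_def)
  have meas: "(\<lambda>t. indicator {0<..} t *\<^sub>R F' t) \<in> borel_measurable lborel"
  proof -
    have "continuous_on {0<..} F'" unfolding F'_def
      using continuous_on_subset[OF continuous_on_ray[OF f], of "{0<..}"]
            continuous_on_subset[OF continuous_on_ray[OF f'], of "{0<..}"]
      by (intro continuous_intros) (auto simp: subset_eq)
    then show ?thesis by (simp add: borel_measurable_continuous_on_indicator)
  qed
  have L0: "has_bochner_integral lborel (\<lambda>t. indicator {0<..} t *\<^sub>R F' t) (lap (deriv f) z + (- z) * lap f z)"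
    using has_bochner_integral_cong_AE[OF _ meas ae] L borel_measurable_has_bochner_integral by blast
  have tip: "((\<lambda>t::real. t *\<^sub>R e) has_vector_derivative e) (at t)" for t
    by (auto intro!: derivative_eq_intros)
  have E: "einterval 0 \<infinity> = {0<..}"
    by (auto simp: einterval_def)
  have "(LBINT t=0..\<infinity>. F' t) = 0 - F 0"
  proof (rule interval_integral_FTC_integrable)
    fix t assume "0 < ereal t"
    then have t: "t > 0" by simp
    have d: "(f has_field_derivative deriv f (t *\<^sub>R e)) (at (t *\<^sub>R e))"
      using f D ray[of t] t by (intro holomorphic_derivI) auto
    have "((\<lambda>x. exp (- (z * x)) * f x) has_field_derivative
       exp (- (z * (t *\<^sub>R e))) * (deriv f (t *\<^sub>R e) + (- z) * f (t *\<^sub>R e))) (at (t *\<^sub>R e))"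
      by (rule derivative_eq_intros d refl | simp add: algebra_simps)+
    from field_vector_diff_chain_at[OF tip this]
    show "(F has_vector_derivative F' t) (at t)"
      by (simp add: F_def[abs_def] F'_def o_def mult_ac)
    have "isCont (\<lambda>t. f (t *\<^sub>R e)) t" "isCont (\<lambda>t. deriv f (t *\<^sub>R e)) t"
      using continuous_on_interior[OF continuous_on_ray[OF f], of t]
       continuous_on_interior[OF continuous_on_ray[OF f'], of t] t by auto
    then show "isCont F' t" unfolding F'_def by (intro continuous_intros)
  next
    show "set_integrable lborel (einterval 0 \<infinity>) F'"
      using L0 by (simp add: set_integrable_def E has_bochner_integral_iff)
  next
    have "continuous_on {0..} F" unfolding F_def by (intro continuous_intros continuous_on_ray f)
    then have "(F \<longlongrightarrow> F 0) (at 0 within {0..})" by (auto simp: continuous_on_def)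
    then have "(F \<longlongrightarrow> F 0) (at_right 0)" by (rule tendsto_within_subset) auto
    then show "((F \<circ> real_of_ereal) \<longlongrightarrow> F 0) (at_right 0)"
      by (simp add: zero_ereal_def ereal_tendsto_simps)
  next
    have "(F \<longlongrightarrow> 0) at_top"
    proof (rule Lim_null_comparison)
      have lim: "((\<lambda>t. K * exp (- ((Re (z * e) - c) * t))) \<longlongrightarrow> K * 0) at_top"
        using z by (intro tendsto_intros filterlim_compose[OF exp_at_bot]
          filterlim_compose[OF filterlim_uminus_at_bot_at_top] filterlim_tendsto_pos_mult_at_top[OF tendsto_const]
          filterlim_ident) auto
      then show "((\<lambda>t. K * exp (- ((Re (z * e) - c) * t))) \<longlongrightarrow> 0) at_top" by simp
      show "\<forall>\<^sub>F t in at_top. norm (F t) \<le> K * exp (- ((Re (z * e) - c) * t))"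
        using eventually_ge_at_top[of 0]
      proof eventually_elim
        case (elim t)
        have "norm (F t) \<le> exp (- (t * Re (z * e))) * (K * exp (c * t))"
          unfolding F_def norm_mult using b[OF elim] by (intro mult_mono) auto
        then show ?case by (simp add: algebra_simps exp_add exp_diff exp_minus divide_simps)
      qed
    qed
    then show "((F \<circ> real_of_ereal) \<longlongrightarrow> 0) (at_left \<infinity>)"
      by (simp add: ereal_tendsto_simps)
  qed simp
  moreover have "(LBINT t=0..\<infinity>. F' t) = lap (deriv f) z + (- z) * lap f z"
    using has_bochner_integral_integral_eq[OF L0]
    by (simp add: interval_lebesgue_integral_def set_lebesgue_integral_def E)
  ultimately show ?thesis by (simp add: F_def algebra_simps)
qed

end

section \<open>Gevrey asymptotics of Laplace transforms\<close>

text \<open>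
  The termwise Laplace transform of the Taylor series at the origin: \<open>\<zeta>\<^sup>k / k!\<close> goes to \<open>1 / z\<^sup>k\<^sup>+\<^sup>1\<close>.
\<close>
definition laplace_fps :: "(complex \<Rightarrow> complex) \<Rightarrow> complex fps" where
  "laplace_fps f = Abs_fps (\<lambda>n. if n = 0 then 0 else (deriv ^^ (n - 1)) f 0)"

text \<open>
  Discs of a fixed radius around the points of the ray are what turns bounds on a function into Gevrey bounds
  on its derivatives.
\<close>
locale laplace_strip = laplace_ray +
  fixes \<rho> :: real
  assumes \<rho>: "\<rho> > 0" and strip: "\<And>t. t \<ge> 0 \<Longrightarrow> cball (t *\<^sub>R e) \<rho> \<subseteq> D"
begin

lemma norm_higher_deriv_ray_le:
  assumes f: "f holomorphic_on D" and b: "\<And>x. x \<in> D \<Longrightarrow> norm (f x) \<le> K * exp (c * norm x)"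
    and c: "c \<ge> 0" and K: "K \<ge> 0" and t: "t \<ge> 0"
  shows "norm ((deriv ^^ n) f (t *\<^sub>R e)) \<le> (K * exp (c * \<rho>) * (fact n / \<rho> ^ n)) * exp (c * t)"
proof -
  have "norm ((deriv ^^ n) f (t *\<^sub>R e)) \<le> fact n * (K * exp (c * (t + \<rho>))) / \<rho> ^ n"
  proof (rule Cauchy_inequality[OF _ _ \<rho>])
    show "f holomorphic_on ball (t *\<^sub>R e) \<rho>" "continuous_on (cball (t *\<^sub>R e) \<rho>) f"
      using f strip[OF t] ball_subset_cball
      by (meson holomorphic_on_subset holomorphic_on_imp_continuous_on continuous_on_subset subset_trans)+
    fix x assume x: "norm (t *\<^sub>R e - x) = \<rho>"
    then have "x \<in> D" using strip[OF t] by (auto simp: dist_norm)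
    then have "norm (f x) \<le> K * exp (c * norm x)" by (rule b)
    also have "norm x \<le> norm (t *\<^sub>R e) + \<rho>" using x norm_triangle_sub[of x "t *\<^sub>R e"] by (simp add: norm_minus_commute)
    then have "K * exp (c * norm x) \<le> K * exp (c * (t + \<rho>))"
      using c K t by (intro mult_left_mono) (auto simp: norm_e intro!: mult_left_mono)
    finally show "norm (f x) \<le> K * exp (c * (t + \<rho>))" .
  qed
  then show ?thesis by (simp add: algebra_simps exp_add)
qed

lemma lap_expansion:
  assumes f: "f holomorphic_on D" and b: "\<And>x. x \<in> D \<Longrightarrow> norm (f x) \<le> K * exp (c * norm x)"
    and c: "c \<ge> 0" and K: "K \<ge> 0" and z: "c < Re (z * e)"
  shows "lap f z = (\<Sum>p<Suc n. fps_nth (laplace_fps f) p / z ^ p) + lap ((deriv ^^ n) f) z / z ^ n"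
proof -
  have z0: "z \<noteq> 0" using z c by auto
  show ?thesis
  proof (induction n)
    case 0
    then show ?case by (simp add: laplace_fps_def)
  next
    case (Suc n)
    have h: "(deriv ^^ n) f holomorphic_on D" using f D by (intro holomorphic_higher_deriv)
    have "lap (deriv ((deriv ^^ n) f)) z = z * lap ((deriv ^^ n) f) z - (deriv ^^ n) f 0"
    proof (rule lap_deriv[OF h _ _ z])
      show "norm ((deriv ^^ n) f (t *\<^sub>R e)) \<le> (K * exp (c * \<rho>) * (fact n / \<rho> ^ n)) * exp (c * t)" if "t \<ge> 0" for t
        by (rule norm_higher_deriv_ray_le[OF f b c K that])
      show "norm (deriv ((deriv ^^ n) f) (t *\<^sub>R e)) \<le> (K * exp (c * \<rho>) * (fact (Suc n) / \<rho> ^ Suc n)) * exp (c * t)" if "t \<ge> 0" for t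
        using norm_higher_deriv_ray_le[OF f b c K that, of "Suc n"] by simp
    qed
    then have "lap ((deriv ^^ n) f) z / z ^ n = (deriv ^^ n) f 0 / z ^ Suc n + lap ((deriv ^^ Suc n) f) z / z ^ Suc n"
      using z0 by (simp add: field_simps)
    then show ?case using Suc.IH by (subst sum.lessThan_Suc) (simp add: laplace_fps_def add.assoc)
  qed
qed

lemma norm_laplace_fps_le:
  assumes f: "f holomorphic_on D" and b: "\<And>x. x \<in> D \<Longrightarrow> norm (f x) \<le> K * exp (c * norm x)"
    and c: "c \<ge> 0" and K: "K \<ge> 0"
  shows "norm (fps_nth (laplace_fps f) n) \<le> K * exp (c * \<rho>) * \<rho> * fact n * (1 / \<rho>) ^ n"
proof (cases n)
  case (Suc m)
  have "norm ((deriv ^^ m) f (0 *\<^sub>R e)) \<le> (K * exp (c * \<rho>) * (fact m / \<rho> ^ m)) * exp (c * 0)"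
    by (rule norm_higher_deriv_ray_le[OF f b c K]) auto
  also have "\<dots> \<le> (K * exp (c * \<rho>) * (fact n / \<rho> ^ m)) * exp (c * 0)"
    using K \<rho> Suc by (intro mult_right_mono mult_left_mono divide_right_mono fact_mono) auto
  also have "fact n / \<rho> ^ m = \<rho> * fact n * (1 / \<rho>) ^ n"
    using \<rho> by (simp add: Suc power_divide del: fact_Suc)
  finally show ?thesis using Suc \<rho> by (simp add: laplace_fps_def mult_ac del: fact_Suc)
qed (use K \<rho> in \<open>simp add: laplace_fps_def\<close>)

text \<open>
  Partial integration once more than the number of subtracted terms requires: with
  \<open>n\<close> terms subtracted, \<open>z\<^sup>n\<close> times the remainder is the next coefficient plus the transform of the
  \<open>n\<close>-th derivative. Staying at distance \<open>1\<close> from the boundary of the half-plane makes the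
  constants uniform.
\<close>
lemma lap_gevrey_asymptotics:
  assumes f: "f holomorphic_on D" and b: "\<And>x. x \<in> D \<Longrightarrow> norm (f x) \<le> K * exp (c * norm x)"
    and c: "c \<ge> 0" and K: "K \<ge> 0" and z: "c + 1 \<le> Re (z * e)"
  shows "norm z ^ n * norm (lap f z - (\<Sum>p<n. fps_nth (laplace_fps f) p / z ^ p))
     \<le> K * exp (c * \<rho>) * (1 + \<rho>) * fact n * (1 / \<rho>) ^ n"
proof -
  have bound: "norm (lap ((deriv ^^ n) f) z) \<le> K * exp (c * \<rho>) * (fact n / \<rho> ^ n)" for n
  proof -
    have "norm (lap ((deriv ^^ n) f) z) \<le> K * exp (c * \<rho>) * (fact n / \<rho> ^ n) / (Re (z * e) - c)"
      by (rule has_lap_bounded(2)[OF _ norm_higher_deriv_ray_le[OF f b c K]])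
         (use z f D in \<open>auto intro!: holomorphic_higher_deriv\<close>)
    also have "\<dots> \<le> K * exp (c * \<rho>) * (fact n / \<rho> ^ n) / 1"
      using z K \<rho> by (intro divide_left_mono) auto
    finally show ?thesis by simp
  qed
  show ?thesis
  proof (cases n)
    case 0
    have "K * exp (c * \<rho>) * 1 \<le> K * exp (c * \<rho>) * (1 + \<rho>)"
      using K \<rho> by (intro mult_left_mono) auto
    then show ?thesis using 0 bound[of 0] by simp
  next
    case (Suc m)
    have z0: "z \<noteq> 0" using z c by auto
    have z': "c < Re (z * e)" using z by simp
    have "norm z ^ n * norm (lap f z - (\<Sum>p<n. fps_nth (laplace_fps f) p / z ^ p))
       = norm (z ^ n * (lap f z - (\<Sum>p<n. fps_nth (laplace_fps f) p / z ^ p)))"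
      by (simp add: norm_mult norm_power)
    also have "z ^ n * (lap f z - (\<Sum>p<n. fps_nth (laplace_fps f) p / z ^ p))
       = fps_nth (laplace_fps f) n + lap ((deriv ^^ n) f) z"
    proof -
      have "lap f z - (\<Sum>p<n. fps_nth (laplace_fps f) p / z ^ p) =
          (fps_nth (laplace_fps f) n + lap ((deriv ^^ n) f) z) / z ^ n"
        using lap_expansion[OF f b c K z', where n=n] by (simp add: add_divide_distrib)
      then show ?thesis using z0 by simp
    qed
    also have "norm \<dots> \<le> K * exp (c * \<rho>) * \<rho> * fact n * (1 / \<rho>) ^ n + K * exp (c * \<rho>) * (fact n / \<rho> ^ n)"
      using norm_laplace_fps_le[OF f b c K] bound by (intro norm_triangle_mono)
    also have "\<dots> = K * exp (c * \<rho>) * (1 + \<rho>) * fact n * (1 / \<rho>) ^ n"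
      using \<rho> by (simp add: field_simps)
    finally show ?thesis .
  qed
qed

end

section \<open>The calculus of asymptotic expansions\<close>

text \<open>
  Asymptotic expansions in powers of \<open>1 / z\<close> along a filter at infinity. They serve to carry an
  analytic identity over to formal series.
\<close>
definition has_expansion :: "complex filter \<Rightarrow> (complex \<Rightarrow> complex) \<Rightarrow> complex fps \<Rightarrow> bool" where
  "has_expansion F l P \<longleftrightarrow> (\<forall>n. (\<lambda>z. l z - (\<Sum>p<n. fps_nth P p / z ^ p)) \<in> O[F](\<lambda>z. 1 / z ^ n))"

context
  fixes F :: "complex filter"
  assumes F: "F \<le> at_infinity"
begin

lemma eventually_norm_ge: "eventually (\<lambda>z. norm z \<ge> b) F"
  using F eventually_at_infinity[of "\<lambda>z::complex. norm z \<ge> b"] unfolding le_filter_def by blast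

lemma bigo_inverse_power: "i \<le> j \<Longrightarrow> (\<lambda>z. k / z ^ j) \<in> O[F](\<lambda>z. 1 / z ^ i)"
proof (rule bigoI[where c="norm k"])
  assume "i \<le> j"
  show "\<forall>\<^sub>F z in F. norm (k / z ^ j) \<le> norm k * norm (1 / z ^ i)"
    using eventually_norm_ge[of 1]
  proof eventually_elim
    case (elim z)
    then have "norm z > 0" by linarith
    then have "norm k / norm z ^ j \<le> norm k / norm z ^ i"
      using \<open>i \<le> j\<close> elim by (intro divide_left_mono power_increasing mult_pos_pos zero_less_power) auto
    then show ?case by (simp add: norm_divide norm_power)
  qed
qed

lemma has_expansion_add:
  assumes "has_expansion F l P" "has_expansion F m Q"
  shows "has_expansion F (\<lambda>z. l z + m z) (P + Q)"
  unfolding has_expansion_def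
proof
  fix n
  have "(\<lambda>z. (l z - (\<Sum>p<n. fps_nth P p / z ^ p)) + (m z - (\<Sum>p<n. fps_nth Q p / z ^ p))) \<in> O[F](\<lambda>z. 1 / z ^ n)"
    using assms unfolding has_expansion_def by (intro sum_in_bigo(1)) blast+
  then show "(\<lambda>z. l z + m z - (\<Sum>p<n. fps_nth (P + Q) p / z ^ p)) \<in> O[F](\<lambda>z. 1 / z ^ n)"
    by (simp add: add_divide_distrib sum.distrib algebra_simps)
qed

text \<open>
  The product of the two partial sums contains the partial sum of the Cauchy product; the remaining
  terms, indexed by \<open>S\<close>, have order at least \<open>n\<close>.
\<close>
lemma has_expansion_mult:
  assumes "has_expansion F l P" "has_expansion F m Q"
  shows "has_expansion F (\<lambda>z. l z * m z) (P * Q)"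
  unfolding has_expansion_def
proof
  fix n
  define p where "p z = (\<Sum>i<n. fps_nth P i / z ^ i)" for z
  define q where "q z = (\<Sum>i<n. fps_nth Q i / z ^ i)" for z
  define S where "S = {..<n} \<times> {..<n} \<inter> {(i, j). \<not> i + j < n}"
  have lp: "(\<lambda>z. l z - p z) \<in> O[F](\<lambda>z. 1 / z ^ n)" and mq: "(\<lambda>z. m z - q z) \<in> O[F](\<lambda>z. 1 / z ^ n)"
    using assms by (auto simp: has_expansion_def p_def q_def)
  have l: "l \<in> O[F](\<lambda>_. 1)" and m: "m \<in> O[F](\<lambda>_. 1)"
    using assms by (auto simp: has_expansion_def dest: spec[of _ 0])
  have "(\<lambda>z. l z - (l z - p z)) \<in> O[F](\<lambda>_. 1)"
    by (intro sum_in_bigo l landau_o.big_trans[OF lp]) (use bigo_inverse_power[of 0 n 1] in simp)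
  then have p: "p \<in> O[F](\<lambda>_. 1)" by simp
  have "(\<Sum>k<n. fps_nth (P * Q) k / z ^ k) = p z * q z - (\<Sum>(i, j)\<in>S. fps_nth P i * fps_nth Q j / z ^ (i + j))" for z
  proof -
    have "p z * q z = (\<Sum>(i, j)\<in>{..<n} \<times> {..<n}. fps_nth P i * fps_nth Q j / z ^ (i + j))"
      by (simp add: p_def q_def sum_product sum.cartesian_product power_add)
    also have "{..<n} \<times> {..<n} = {(i, j). i + j < n} \<union> S" by (auto simp: S_def)
    also have "(\<Sum>(i, j)\<in>{(i, j). i + j < n} \<union> S. fps_nth P i * fps_nth Q j / z ^ (i + j)) =
       (\<Sum>(i, j)\<in>{(i, j). i + j < n}. fps_nth P i * fps_nth Q j / z ^ (i + j)) +
       (\<Sum>(i, j)\<in>S. fps_nth P i * fps_nth Q j / z ^ (i + j))"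
      by (rule sum.union_disjoint)
         (auto simp: S_def intro: finite_subset[of _ "{..<n} \<times> {..<n}"])
    also have "(\<Sum>(i, j)\<in>{(i, j). i + j < n}. fps_nth P i * fps_nth Q j / z ^ (i + j))
       = (\<Sum>k<n. fps_nth (P * Q) k / z ^ k)"
      unfolding sum.triangle_reindex fps_mult_nth
      by (intro sum.cong refl) (simp add: sum_divide_distrib atLeast0AtMost)
    finally show ?thesis by simp
  qed
  then have eq: "(\<lambda>z. l z * m z - (\<Sum>k<n. fps_nth (P * Q) k / z ^ k)) =
    (\<lambda>z. (l z - p z) * m z + p z * (m z - q z) + (\<Sum>(i, j)\<in>S. fps_nth P i * fps_nth Q j / z ^ (i + j)))"
    by (auto simp: algebra_simps)
  have "(\<lambda>z. (l z - p z) * m z) \<in> O[F](\<lambda>z. 1 / z ^ n)" "(\<lambda>z. p z * (m z - q z)) \<in> O[F](\<lambda>z. 1 / z ^ n)"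
    using landau_o.big_mult[OF lp m] landau_o.big_mult[OF p mq] by simp_all
  moreover have "(\<lambda>z. \<Sum>(i, j)\<in>S. fps_nth P i * fps_nth Q j / z ^ (i + j)) \<in> O[F](\<lambda>z. 1 / z ^ n)"
    unfolding case_prod_unfold by (intro big_sum_in_bigo bigo_inverse_power) (auto simp: S_def)
  ultimately show "(\<lambda>z. l z * m z - (\<Sum>k<n. fps_nth (P * Q) k / z ^ k)) \<in> O[F](\<lambda>z. 1 / z ^ n)"
    unfolding eq by (intro sum_in_bigo)
qed

lemma has_expansion_const: "has_expansion F (\<lambda>_. k) (fps_const k)"
  unfolding has_expansion_def
proof
  fix n show "(\<lambda>z. k - (\<Sum>p<n. fps_nth (fps_const k) p / z ^ p)) \<in> O[F](\<lambda>z. 1 / z ^ n)"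
  proof (cases n)
    case 0
    then show ?thesis using bigo_inverse_power[of 0 0 k] by simp
  next
    case (Suc m)
    have "(\<Sum>p<Suc m. fps_nth (fps_const k) p / z ^ p) = k" for z
      by (subst sum.remove[of _ 0]) auto
    then show ?thesis by (simp add: Suc)
  qed
qed

lemma has_expansion_inverse: "has_expansion F (\<lambda>z. 1 / z) fps_X"
  unfolding has_expansion_def
proof
  fix n show "(\<lambda>z. 1 / z - (\<Sum>p<n. fps_nth fps_X p / z ^ p)) \<in> O[F](\<lambda>z. 1 / z ^ n)"
  proof (cases "n \<le> 1")
    case True
    then have "(\<Sum>p<n. fps_nth fps_X p / z ^ p) = 0" for z :: complex
      by (intro sum.neutral) auto
    then show ?thesis using bigo_inverse_power[OF True, of 1] by simp
  next
    case False
    have "(\<Sum>p<n. fps_nth fps_X p / z ^ p) = 1 / z" for z :: complex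
      using False by (subst sum.remove[of _ 1]) auto
    then show ?thesis by simp
  qed
qed

lemma has_expansion_uminus: "has_expansion F l P \<Longrightarrow> has_expansion F (\<lambda>z. - l z) (- P)"
  using has_expansion_mult[OF has_expansion_const[of "-1"]] by (simp flip: fps_const_neg)

lemma has_expansion_diff:
  "has_expansion F l P \<Longrightarrow> has_expansion F m Q \<Longrightarrow> has_expansion F (\<lambda>z. l z - m z) (P - Q)"
  using has_expansion_add[OF _ has_expansion_uminus] by fastforce

lemma has_expansion_power: "has_expansion F l P \<Longrightarrow> has_expansion F (\<lambda>z. l z ^ n) (P ^ n)"
proof (induction n)
  case 0
  then show ?case using has_expansion_const[of 1] by simp
qed (simp add: has_expansion_mult)

lemma has_expansion_cong:
  assumes "has_expansion F l P" "eventually (\<lambda>z. l z = m z) F"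
  shows "has_expansion F m P"
  unfolding has_expansion_def
proof
  fix n
  have "eventually (\<lambda>z. l z - (\<Sum>p<n. fps_nth P p / z ^ p) = m z - (\<Sum>p<n. fps_nth P p / z ^ p)) F"
    using assms(2) by eventually_elim simp
  from landau_o.big.in_cong[OF this] show "(\<lambda>z. m z - (\<Sum>p<n. fps_nth P p / z ^ p)) \<in> O[F](\<lambda>z. 1 / z ^ n)"
    using assms(1) unfolding has_expansion_def by blast
qed

lemma has_expansion_zero_unique:
  assumes "has_expansion F (\<lambda>_. 0) P" "F \<noteq> bot"
  shows "P = 0"
proof (rule fps_ext)
  fix n show "fps_nth P n = fps_nth 0 n"
  proof (induction n rule: less_induct)
    case (less n)
    have "(\<lambda>z. 0 - (\<Sum>p<Suc n. fps_nth P p / z ^ p)) \<in> O[F](\<lambda>z. 1 / z ^ Suc n)"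
      using assms(1) unfolding has_expansion_def by blast
    also have "(\<lambda>z. 0 - (\<Sum>p<Suc n. fps_nth P p / z ^ p)) = (\<lambda>z. - (fps_nth P n / z ^ n))"
      using less by (auto simp: fun_eq_iff)
    finally obtain c where c: "c > 0" "\<forall>\<^sub>F z in F. norm (- (fps_nth P n / z ^ n)) \<le> c * norm (1 / z ^ Suc n)"
      by (elim landau_o.bigE)
    show ?case
    proof (rule ccontr)
      assume "fps_nth P n \<noteq> fps_nth 0 n"
      then have P: "norm (fps_nth P n) > 0" by simp
      have "\<forall>\<^sub>F z in F. False"
        using c(2) eventually_norm_ge[of "c / norm (fps_nth P n) + 1"]
      proof eventually_elim
        case (elim z)
        have z: "norm z > 0" using elim(2) c(1) P by (smt (verit) divide_pos_pos)
        have "norm (fps_nth P n) * norm z \<le> c"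
          using elim(1) z by (simp add: norm_divide norm_mult norm_power field_simps)
        moreover have "c < norm (fps_nth P n) * norm z"
        proof -
          have "(c / norm (fps_nth P n) + 1) * norm (fps_nth P n) \<le> norm z * norm (fps_nth P n)"
            using elim(2) by (intro mult_right_mono) auto
          moreover have "(c / norm (fps_nth P n) + 1) * norm (fps_nth P n) = c + norm (fps_nth P n)"
            using P by (simp add: field_simps)
          ultimately have "c < norm z * norm (fps_nth P n)" using P by linarith
          then show ?thesis by (simp add: mult.commute)
        qed
        ultimately show False by simp
      qed
      then show False using assms(2) by simp
    qed
  qed
qed

end

section \<open>The convolution equation of the third Painleve equation\<close>

text \<open>
  The Borel image of the right-hand side of the equation for \<open>u = w - a\<close>,
  \<open>a u'' - 4 \<gamma> a\<^sup>3 u = u'\<^sup>2 - u u'' - (a + u) u' / z + (\<alpha> (a + u)\<^sup>3 + \<beta> (a + u)) / z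
    + 6 \<gamma> a\<^sup>2 u\<^sup>2 + 4 \<gamma> a u\<^sup>3 + \<gamma> u\<^sup>4\<close>,
  without the term \<open>(\<alpha> a\<^sup>3 + \<beta> a) / z\<close>, whose image is a constant. Each summand is a
  convolution and therefore small. The factors \<open>x\<close> and \<open>x\<^sup>2\<close> stem from \<open>u'\<close> and \<open>u''\<close>.
\<close>
definition borel_nonlinearity :: "complex \<Rightarrow> complex \<Rightarrow> complex \<Rightarrow> complex \<Rightarrow> (complex \<Rightarrow> complex) \<Rightarrow> complex \<Rightarrow> complex" where
  "borel_nonlinearity \<alpha> \<beta> \<gamma> a f = (\<lambda>x.
     conv (\<lambda>x. x * f x) (\<lambda>x. x * f x) x + ((-1) * conv f (\<lambda>x. x * (x * f x)) x
     + (conv (\<lambda>_. 1) (\<lambda>x. a * (x * f x) + (conv f (\<lambda>x. x * f x) x + ((3 * \<alpha> * a\<^sup>2 + \<beta>) * f x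
          + (3 * \<alpha> * a * conv f f x + \<alpha> * conv f (conv f f) x)))) x
     + (6 * \<gamma> * a\<^sup>2 * conv f f x + (4 * \<gamma> * a * conv f (conv f f) x + \<gamma> * conv (conv f f) (conv f f) x)))))"

text \<open>
  The left-hand side is the number that the rules for controlled pairs yield, unsimplified, for the nonlinear
  operator, with \<open>n = norm \<zeta>\<close> and \<open>\<eta>\<close> the price of one convolution. One factor \<open>\<eta>\<close> is extracted,
  further ones are estimated by \<open>1\<close>, and the growth in \<open>n\<close> is at most quadratic.
\<close>
lemma contraction_factor_le:
  fixes \<eta> n A B C D E G H :: real
  assumes \<eta>: "0 \<le> \<eta>" "\<eta> \<le> 1" and n: "0 \<le> n"
    and nn: "0 \<le> A" "0 \<le> B" "0 \<le> C" "0 \<le> D" "0 \<le> E" "0 \<le> G" "0 \<le> H"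
  shows "\<eta> * ((n * 1) * (n * 1)) + (1 * (\<eta> * (1 * (n * (n * 1)))) + (\<eta> * (1 * (A * (n * 1) + (\<eta> * (1 * (n * 1)) + (B * 1 +
      (C * (\<eta> * (1 * 1)) + D * (\<eta> * (1 * (\<eta> * (1 * 1)))))))))
     + (E * (\<eta> * (1 * 1)) + (G * (\<eta> * (1 * (\<eta> * (1 * 1)))) + H * (\<eta> * ((\<eta> * (1 * 1)) * (\<eta> * (1 * 1))))))))
    \<le> \<eta> * (3 + A + B + C + D + E + G + H) * (1 + n\<^sup>2)"
proof -
  define N where "N = 1 + n\<^sup>2"
  have N: "1 \<le> N" "n * n \<le> N" "n \<le> N"
  proof -
    have "0 \<le> (n - 1)\<^sup>2" by simp
    then have "n * 2 \<le> 1 + n * n" by (simp add: power2_eq_square algebra_simps)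
    then show "n \<le> N" using n by (simp add: N_def power2_eq_square)
  qed (auto simp: N_def power2_eq_square)
  have \<eta>2: "\<eta> * \<eta> \<le> 1" using \<eta> by (simp add: mult_le_one)
  have up: "X * u \<le> X * N" if "0 \<le> X" "u \<le> 1" for X u :: real
    using that N(1) by (intro mult_left_mono) auto
  have "n * n + n * n + (A * n + \<eta> * n + B + C * \<eta> + D * (\<eta> * \<eta>)) + E + G * \<eta> + H * (\<eta> * \<eta>)
    \<le> N + N + (A * N + 1 * N + B * N + C * N + D * N) + E * N + G * N + H * N"
    using N n \<eta> \<eta>2 nn up[of B 1] up[of E 1]
    by (intro add_mono mult_mono up mult_left_mono order_refl) auto
  then have "\<eta> * (n * n + n * n + (A * n + \<eta> * n + B + C * \<eta> + D * (\<eta> * \<eta>)) + E + G * \<eta> + H * (\<eta> * \<eta>))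
    \<le> \<eta> * (N + N + (A * N + 1 * N + B * N + C * N + D * N) + E * N + G * N + H * N)"
    using \<eta> by (intro mult_left_mono)
  then show ?thesis unfolding N_def[symmetric] by (simp add: algebra_simps)
qed

lemma (in controlled_pairs) ctrl_borel_nonlinearity:
  assumes "ctrl 1 f g" "8 * K / c \<le> 1"
  shows "ctrl (8 * K / c * (3 + norm a + norm (3 * \<alpha> * a\<^sup>2 + \<beta>) + norm (3 * \<alpha> * a) + norm \<alpha>
      + norm (6 * \<gamma> * a\<^sup>2) + norm (4 * \<gamma> * a) + norm \<gamma>) * (1 + (norm \<zeta>)\<^sup>2))
    (borel_nonlinearity \<alpha> \<beta> \<gamma> a f) (borel_nonlinearity \<alpha> \<beta> \<gamma> a g)"
proof -
  have x: "ctrl (norm \<zeta> * 1) (\<lambda>x. x * f x) (\<lambda>x. x * g x)" by (rule ctrl_mult_ident[OF assms(1)])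
  note rules = ctrl_add ctrl_cmult ctrl_conv x ctrl_mult_ident[OF x] ctrl_one assms(1)
  have "0 \<le> 8 * K / c" using K c by simp
  from contraction_factor_le[OF this assms(2) norm_ge_zero[of \<zeta>], of "norm a" "norm (3 * \<alpha> * a\<^sup>2 + \<beta>)"
     "norm (3 * \<alpha> * a)" "norm \<alpha>" "norm (6 * \<gamma> * a\<^sup>2)" "norm (4 * \<gamma> * a)" "norm \<gamma>"]
  show ?thesis
    unfolding borel_nonlinearity_def
    by - (rule ctrl_mono, (rule rules)+, simp only: norm_minus_cancel norm_one norm_ge_zero simp_thms)
qed

text \<open>
  The symbol grows quadratically, like the loss \<open>1 + (norm x)\<^sup>2\<close> in the estimate of the nonlinear
  operator; this balance is the hypothesis with \<open>Q0\<close>. First \<open>K\<close> is chosen so that the inhomogeneous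
  term fills at most half of the ball, then \<open>c\<close> so large that the nonlinear operator has Lipschitz
  constant at most \<open>1/2\<close> and fills the other half.
\<close>
lemma piii_convolution_equation_solvable:
  fixes \<alpha> \<beta> \<gamma> a :: complex
  assumes D: "open D" "convex D" "0 \<in> D" and a: "a \<noteq> 0"
    and Q0: "\<And>x. x \<in> D \<Longrightarrow> 1 + (norm x)\<^sup>2 \<le> Q0 * norm (x\<^sup>2 - 4 * \<gamma> * a\<^sup>2)"
  obtains f c K where "f holomorphic_on D" "c \<ge> 0" "K \<ge> 0"
    "\<And>x. x \<in> D \<Longrightarrow> norm (f x) \<le> K * exp (c * norm x)"
    "\<And>x. x \<in> D \<Longrightarrow> a * (x\<^sup>2 - 4 * \<gamma> * a\<^sup>2) * f x = (\<alpha> * a ^ 3 + \<beta> * a) + borel_nonlinearity \<alpha> \<beta> \<gamma> a f x"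
proof -
  define k where "k = \<alpha> * a ^ 3 + \<beta> * a"
  define P where "P x = a * (x\<^sup>2 - 4 * \<gamma> * a\<^sup>2)" for x
  define Q where "Q = Q0 / norm a"
  have Q: "1 + (norm x)\<^sup>2 \<le> Q * norm (P x)" if "x \<in> D" for x
    using Q0[OF that] a by (simp add: Q_def P_def norm_mult)
  have pos: "0 < 1 + (norm x)\<^sup>2" for x :: complex by (simp add: add_pos_nonneg)
  have P0: "norm (P x) > 0" if "x \<in> D" for x
    using Q[OF that] pos[of x] by (cases "P x = 0") auto
  have Qpos: "Q > 0"
    using Q[OF D(3)] P0[OF D(3)] pos[of 0] by (smt (verit) zero_less_mult_iff)
  have div: "norm (y / P x) \<le> Q * s" if "x \<in> D" "norm y \<le> s * (1 + (norm x)\<^sup>2)" for x y s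
  proof -
    have "0 \<le> s" using that(2) pos[of x] norm_ge_zero[of y] by (smt (verit) mult_neg_pos)
    then have "norm y \<le> s * (Q * norm (P x))"
      using that(2) Q[OF that(1)] by (meson mult_left_mono order_trans)
    then show ?thesis using P0[OF that(1)] by (simp add: norm_divide divide_le_eq mult_ac)
  qed
  define M where "M = 3 + norm a + norm (3 * \<alpha> * a\<^sup>2 + \<beta>) + norm (3 * \<alpha> * a) + norm \<alpha>
      + norm (6 * \<gamma> * a\<^sup>2) + norm (4 * \<gamma> * a) + norm \<gamma>"
  have M: "M > 0" unfolding M_def by (intro add_pos_nonneg) auto
  define K where "K = 4 + 8 * norm k * Q"
  have K: "K \<ge> 4" using Qpos by (simp add: K_def)
  define c where "c = 8 * K * (1 + 2 * M * Q)"
  have MQ: "M * Q > 0" using M Qpos by simp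
  have c: "c > 0" using K MQ by (simp add: c_def mult.assoc add_pos_pos)
  have \<eta>: "8 * K / c = 1 / (1 + 2 * (M * Q))" using K by (simp add: c_def mult.assoc)
  have \<eta>1: "8 * K / c \<le> 1" and \<eta>M: "Q * (8 * K / c * M) \<le> 1 / 2"
    unfolding \<eta> using MQ by (simp_all add: field_simps)
  define m where "m x = weight c (norm x)" for x :: complex
  have m0: "0 \<le> m x" for x by (simp add: m_def weight_nonneg)
  have mcont: "continuous_on D m"
    unfolding m_def using c by (intro continuous_on_weight continuous_intros) auto
  define \<Phi> where "\<Phi> f x = (k + borel_nonlinearity \<alpha> \<beta> \<gamma> a f x) / P x" for f x
  define X where "X = {f. f holomorphic_on D \<and> (\<forall>x\<in>D. norm (f x) \<le> K * m x)}"
  have key: "borel_nonlinearity \<alpha> \<beta> \<gamma> a f holomorphic_on D"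
     "norm (borel_nonlinearity \<alpha> \<beta> \<gamma> a f x / P x) \<le> 1 / 2 * (K * m x)"
     "norm (\<Phi> f x - \<Phi> g x) \<le> d / 2 * m x"
    if fg: "f \<in> X" "g \<in> X" and x: "x \<in> D" and d: "d \<ge> 0" and le: "\<And>x. x \<in> D \<Longrightarrow> norm (f x - g x) \<le> d * m x" for f g x d
  proof -
    interpret controlled_pairs D c K d x
      using D x c K d by unfold_locales
    have "ctrl 1 f g"
      unfolding ctrl_def
    proof (intro conjI ballI)
      fix t :: real assume "t \<in> {0..1}"
      then have t: "0 \<le> t" "t \<le> 1" by auto
      note tx = scaleR_in_convex[OF D(2,3) x t]
      have "m (t *\<^sub>R x) = weight c (t * norm x)" using t by (simp add: m_def)
      then show "norm (f (t *\<^sub>R x)) \<le> 1 * K * weight c (t * norm x)"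
        "norm (g (t *\<^sub>R x)) \<le> 1 * K * weight c (t * norm x)"
        "norm (f (t *\<^sub>R x) - g (t *\<^sub>R x)) \<le> 1 * d * weight c (t * norm x)"
        using fg tx le[OF tx] by (auto simp: X_def)
    qed (use fg in \<open>auto simp: X_def\<close>)
    from ctrl_borel_nonlinearity[OF this \<eta>1, of a \<alpha> \<beta> \<gamma>]
    have N: "ctrl (8 * K / c * M * (1 + (norm x)\<^sup>2)) (borel_nonlinearity \<alpha> \<beta> \<gamma> a f) (borel_nonlinearity \<alpha> \<beta> \<gamma> a g)"
      by (simp add: M_def)
    then show "borel_nonlinearity \<alpha> \<beta> \<gamma> a f holomorphic_on D" by (simp add: ctrl_def)
    have n1: "norm (borel_nonlinearity \<alpha> \<beta> \<gamma> a f x) \<le> (8 * K / c * M * (K * m x)) * (1 + (norm x)\<^sup>2)"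
     and n2: "norm (borel_nonlinearity \<alpha> \<beta> \<gamma> a f x - borel_nonlinearity \<alpha> \<beta> \<gamma> a g x) \<le> (8 * K / c * M * (d * m x)) * (1 + (norm x)\<^sup>2)"
      using N unfolding ctrl_def m_def by (auto dest!: bspec[of _ _ 1] simp: mult_ac)
    have half: "Q * (8 * K / c * M * y) \<le> 1 / 2 * y" if "y \<ge> 0" for y
      using mult_right_mono[OF \<eta>M that] by (simp add: mult_ac)
    show "norm (borel_nonlinearity \<alpha> \<beta> \<gamma> a f x / P x) \<le> 1 / 2 * (K * m x)"
      by (rule order_trans[OF div[OF x n1] half]) (use K m0 in auto)
    have "\<Phi> f x - \<Phi> g x = (borel_nonlinearity \<alpha> \<beta> \<gamma> a f x - borel_nonlinearity \<alpha> \<beta> \<gamma> a g x) / P x"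
      by (simp add: \<Phi>_def diff_divide_distrib add_divide_distrib)
    then show "norm (\<Phi> f x - \<Phi> g x) \<le> d / 2 * m x"
      using order_trans[OF div[OF x n2] half] d m0 by simp
  qed
  have "\<Phi> f \<in> X" if f: "f \<in> X" for f
  proof -
    have 0: "0 \<le> (0::real)" "\<And>x. x \<in> D \<Longrightarrow> norm (f x - f x) \<le> 0 * m x" by auto
    have "norm (\<Phi> f x) \<le> K * m x" if x: "x \<in> D" for x
    proof -
      have "norm k \<le> norm k * (1 + (norm x)\<^sup>2)" by (simp add: mult_le_cancel_left1)
      then have "norm (k / P x) \<le> Q * norm k" by (rule div[OF x])
      also have "\<dots> \<le> Q * norm k * (4 * m x)"
      proof -
        have "1 \<le> 4 * m x" using weight_ge[of c "norm x"] c by (simp add: m_def)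
        moreover have "0 \<le> Q * norm k" using Qpos by simp
        ultimately show ?thesis by (metis mult.right_neutral mult_left_mono)
      qed
      also have "\<dots> \<le> 1 / 2 * (K * m x)"
        using m0[of x] by (simp add: K_def algebra_simps)
      finally have "norm (k / P x + borel_nonlinearity \<alpha> \<beta> \<gamma> a f x / P x) \<le> 1 / 2 * (K * m x) + 1 / 2 * (K * m x)"
        using key(2)[OF f f x 0] by (rule norm_triangle_mono)
      then show ?thesis by (simp add: \<Phi>_def add_divide_distrib)
    qed
    moreover have "\<Phi> f holomorphic_on D"
      unfolding \<Phi>_def using key(1)[OF f f D(3) 0] P0
      by (auto intro!: holomorphic_intros simp: P_def)
    ultimately show ?thesis by (simp add: X_def)
  qed
  then obtain f where f: "f \<in> X" "\<And>x. x \<in> D \<Longrightarrow> \<Phi> f x = f x"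
    using contraction_fixed_point[of D K m \<Phi>] D(1) K mcont m0 key(3) unfolding X_def by (smt (verit, best))
  show thesis
  proof (rule that)
    show "f holomorphic_on D" "c \<ge> 0" "K \<ge> 0" using f c K by (auto simp: X_def)
    show "norm (f x) \<le> K * exp (c * norm x)" if "x \<in> D" for x
    proof -
      have "norm (f x) \<le> K * m x" using f(1) that by (simp add: X_def)
      also have "\<dots> \<le> K * exp (c * norm x)" using weight_le_exp[of c "norm x"] c K by (simp add: m_def)
      finally show ?thesis .
    qed
    show "a * (x\<^sup>2 - 4 * \<gamma> * a\<^sup>2) * f x = (\<alpha> * a ^ 3 + \<beta> * a) + borel_nonlinearity \<alpha> \<beta> \<gamma> a f x" if "x \<in> D" for x
      using f(2)[OF that] P0[OF that] by (simp add: \<Phi>_def k_def P_def divide_eq_eq mult.commute)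
  qed
qed

section \<open>Solutions on half-planes\<close>

lemma deriv_power_mult_ident:
  assumes "open D" "0 \<in> D" "f holomorphic_on D"
  shows "(deriv ^^ n) (\<lambda>x. - (x * f x)) 0 = - (of_nat n * (deriv ^^ (n - 1)) f 0)"
proof -
  have "(deriv ^^ n) (\<lambda>x. (- x) * f x) 0 =
     (\<Sum>i=0..n. of_nat (n choose i) * (deriv ^^ i) uminus 0 * (deriv ^^ (n - i)) f 0)"
    by (rule higher_deriv_mult[OF _ assms(3,1,2)]) (intro holomorphic_intros)
  also have "\<dots> = (\<Sum>i\<in>{1} \<inter> {0..n}. of_nat (n choose i) * (deriv ^^ i) uminus 0 * (deriv ^^ (n - i)) f 0)"
  proof (rule sum.mono_neutral_right)
    show "\<forall>i\<in>{0..n} - {1} \<inter> {0..n}. of_nat (n choose i) * (deriv ^^ i) uminus 0 * (deriv ^^ (n - i)) f 0 = 0"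
    proof
      fix i assume "i \<in> {0..n} - {1} \<inter> {0..n}"
      then have "i \<noteq> 1" by auto
      then have "(deriv ^^ i) (uminus :: complex \<Rightarrow> complex) 0 = 0"
        using higher_deriv_uminus[of "\<lambda>x. x" UNIV 0 i] by (simp add: higher_deriv_ident)
      then show "of_nat (n choose i) * (deriv ^^ i) uminus 0 * (deriv ^^ (n - i)) f 0 = 0" by simp
    qed
  qed auto
  also have "\<dots> = - (of_nat n * (deriv ^^ (n - 1)) f 0)"
    by (cases n) (auto simp: algebra_simps)
  finally show ?thesis by simp
qed

text \<open>
  On the side of formal series, multiplication of the Borel transform by \<open>- x\<close> is \<open>d/dz\<close> as well.
\<close>
lemma laplace_fps_mult_ident:
  assumes "open D" "0 \<in> D" "f holomorphic_on D"
  shows "laplace_fps (\<lambda>x. - (x * f x)) = - (fps_X\<^sup>2 * fps_deriv (laplace_fps f))"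
proof (rule fps_ext)
  fix n
  have "fps_nth (fps_X\<^sup>2 * fps_deriv (laplace_fps f)) n = (if n < 2 then 0 else of_nat (n - 1) * fps_nth (laplace_fps f) (n - 1))"
  proof (cases "n < 2")
    case False
    then have "n = Suc (Suc (n - 2))" by simp
    moreover from this have "n - 1 = Suc (n - 2)" by linarith
    ultimately show ?thesis using False by (simp add: fps_X_power_mult_nth)
  qed (simp add: fps_X_power_mult_nth)
  moreover have "fps_nth (laplace_fps (\<lambda>x. - (x * f x))) n = - (if n < 2 then 0 else of_nat (n - 1) * fps_nth (laplace_fps f) (n - 1))"
    using deriv_power_mult_ident[OF assms, of "n - 1"] by (auto simp: laplace_fps_def)
  ultimately show "fps_nth (laplace_fps (\<lambda>x. - (x * f x))) n = fps_nth (- (fps_X\<^sup>2 * fps_deriv (laplace_fps f))) n"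
    by simp
qed

lemma norm_mult_ident_le:
  assumes "norm (y :: complex) \<le> K * exp (c * norm x)"
  shows "norm (x * y) \<le> K * exp ((c + 1) * norm x)"
proof -
  have "norm x \<le> exp (norm x)" using exp_ge_add_one_self[of "norm x"] by linarith
  then have "norm (x * y) \<le> exp (norm x) * (K * exp (c * norm x))"
    unfolding norm_mult using assms by (intro mult_mono) auto
  then show ?thesis by (simp add: algebra_simps exp_add)
qed

text \<open>
  With \<open>X = 1 / z\<close>, the series \<open>U\<close> and \<open>V\<close> are the formal first and second derivatives of \<open>F\<close> with
  respect to \<open>z\<close>, so the hypothesis is the equation multiplied by \<open>w\<close>. The conclusion is written
  with \<open>X d/dX\<close> instead.
\<close>
lemma piii_formal_equation_of_derivatives:
  fixes F :: "complex fps"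
  assumes U: "U = - (fps_X\<^sup>2 * fps_deriv F)" and V: "V = - (fps_X\<^sup>2 * fps_deriv U)"
   and eq: "F * V - U\<^sup>2 + fps_X * (F * U) - fps_X * (fps_const \<alpha> * F ^ 3 + fps_const \<beta> * F)
     - fps_const \<gamma> * F ^ 4 - fps_const \<delta> = 0"
  shows "fps_const \<gamma> * F ^ 4 + fps_const \<delta> = fps_X * piii_rhs \<alpha> \<beta> F"
proof -
  define G where "G = fps_deriv F"
  define H where "H = fps_deriv G"
  have dU: "fps_deriv U = - (2 * fps_X * G + fps_X\<^sup>2 * H)"
    by (simp add: U G_def H_def power2_eq_square algebra_simps)
  then have V': "V = fps_X\<^sup>2 * (2 * fps_X * G + fps_X\<^sup>2 * H)" unfolding V dU by algebra
  have U': "U = - (fps_X\<^sup>2 * G)" by (simp add: U G_def)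
  have R: "piii_rhs \<alpha> \<beta> F = fps_X * (F * (fps_X * (G + fps_X * H)) - (fps_X * G)\<^sup>2)
     - fps_const \<alpha> * F ^ 3 - fps_const \<beta> * F"
    by (simp add: piii_rhs_def G_def H_def)
  show ?thesis using eq unfolding R U' V' by algebra
qed

context laplace_strip
begin

lemma has_lap_one: "0 < Re (z * e) \<Longrightarrow> has_lap (\<lambda>_. 1) z (1 / z)"
proof -
  assume z: "0 < Re (z * e)"
  then have z0: "z \<noteq> 0" by auto
  have 1: "has_lap (\<lambda>_. 1) z (lap (\<lambda>_. 1) z)"
    by (rule has_lap_bounded(1)[where K=1 and c=0]) (use z in auto)
  have "lap (deriv (\<lambda>_. 1)) z = z * lap (\<lambda>_. 1) z - 1"
    by (rule lap_deriv[where K=1 and K'=0 and c=0]) (use z in auto)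
  moreover have "lap (deriv (\<lambda>_. 1)) z = 0"
    by (simp add: lap_def lap_integrand_def[abs_def])
  ultimately have "lap (\<lambda>_. 1) z = 1 / z" using z0 by (simp add: field_simps)
  then show ?thesis using 1 by simp
qed

text \<open>
  Both sides of the convolution equation have a Laplace transform, computed by the rules; equating them
  gives the differential equation multiplied by \<open>w\<close>.
\<close>
lemma lap_solves_piii:
  fixes \<alpha> \<beta> \<gamma> \<delta> a :: complex
  assumes f: "f holomorphic_on D" and c: "c \<ge> 0" and b: "\<And>x. x \<in> D \<Longrightarrow> norm (f x) \<le> K * exp (c * norm x)"
    and eq: "\<And>x. x \<in> D \<Longrightarrow> a * (x\<^sup>2 - 4 * \<gamma> * a\<^sup>2) * f x = (\<alpha> * a ^ 3 + \<beta> * a) + borel_nonlinearity \<alpha> \<beta> \<gamma> a f x"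
    and a4: "\<gamma> * a ^ 4 + \<delta> = 0" and z: "c + 2 < Re (z * e)"
  defines "w \<equiv> a + lap f z" and "w1 \<equiv> lap (\<lambda>x. - (x * f x)) z" and "w2 \<equiv> lap (\<lambda>x. - (x * - (x * f x))) z"
  shows "w * w2 - w1\<^sup>2 + 1 / z * (w * w1) - 1 / z * (\<alpha> * w ^ 3 + \<beta> * w) - \<gamma> * w ^ 4 - \<delta> = 0"
proof -
  have z0: "z \<noteq> 0" using z c by auto
  have K: "K \<ge> 0" using b[OF ray[of 0]] order_trans[OF norm_ge_zero] by fastforce
  define u where "u = lap f z"
  have "has_lap f z u" unfolding u_def
    by (rule has_lap_bounded(1)[OF f _, of K c]) (use b[OF ray] z in \<open>auto simp: norm_e\<close>)
  moreover have b1: "norm (x * f x) \<le> K * exp ((c + 1) * norm x)" if "x \<in> D" for x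
    by (rule norm_mult_ident_le[OF b[OF that]])
  have x1: "has_lap (\<lambda>x. - (x * f x)) z w1" unfolding w1_def
    by (rule has_lap_bounded(1)[of _ K "c + 1"]) (use b1[OF ray] z f in \<open>auto simp: norm_e intro!: holomorphic_intros\<close>)
  have b2: "norm (x * (x * f x)) \<le> K * exp ((c + 2) * norm x)" if "x \<in> D" for x
    using norm_mult_ident_le[OF b1[OF that]] by (simp add: add.commute)
  have x2: "has_lap (\<lambda>x. - (x * - (x * f x))) z w2" unfolding w2_def
    by (rule has_lap_bounded(1)[of _ K "c + 2"]) (use b2[OF ray] z f in \<open>auto simp: norm_e intro!: holomorphic_intros\<close>)
  have 0: "has_lap f z u" by fact
  have 1: "has_lap (\<lambda>x. x * f x) z (- w1)" using has_lap_cmult[OF x1, of "-1"] by simp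
  have 2: "has_lap (\<lambda>x. x * (x * f x)) z w2" using x2 by simp
  have I: "has_lap (\<lambda>_. 1) z (1 / z)" using z c by (intro has_lap_one) auto
  have D0: "0 \<in> D" using ray[of 0] by simp
  have hc: "conv p q holomorphic_on D" if "p holomorphic_on D" "q holomorphic_on D" for p q
    using holomorphic_conv[OF D D0 that] .
  have hc': "(\<lambda>x. conv p q x) holomorphic_on D" if "p holomorphic_on D" "q holomorphic_on D" for p q
    using hc[OF that] .
  have "has_lap (\<lambda>x. (\<alpha> * a ^ 3 + \<beta> * a) * 1 + borel_nonlinearity \<alpha> \<beta> \<gamma> a f x) z
     ((\<alpha> * a ^ 3 + \<beta> * a) * (1 / z) + (- w1 * - w1 + ((-1) * (u * w2)
      + (1 / z * (a * - w1 + (u * - w1 + ((3 * \<alpha> * a\<^sup>2 + \<beta>) * u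
          + (3 * \<alpha> * a * (u * u) + \<alpha> * (u * (u * u))))))
     + (6 * \<gamma> * a\<^sup>2 * (u * u) + (4 * \<gamma> * a * (u * (u * u)) + \<gamma> * ((u * u) * (u * u))))))))"
    unfolding borel_nonlinearity_def
    by (intro has_lap_add has_lap_cmult has_lap_conv 0 1 2 I holomorphic_intros hc hc' f)
  moreover have "has_lap (\<lambda>x. a * (x * (x * f x)) + (- (4 * \<gamma> * a ^ 3)) * f x) z (a * w2 + (- (4 * \<gamma> * a ^ 3)) * u)"
    by (intro has_lap_add has_lap_cmult 0 2)
  then have "has_lap (\<lambda>x. (\<alpha> * a ^ 3 + \<beta> * a) * 1 + borel_nonlinearity \<alpha> \<beta> \<gamma> a f x) z (a * w2 + (- (4 * \<gamma> * a ^ 3)) * u)"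
    by (rule has_lap_cong) (use eq in \<open>simp add: algebra_simps power2_eq_square power3_eq_cube\<close>)
  ultimately have E: "(\<alpha> * a ^ 3 + \<beta> * a) * (1 / z) + (- w1 * - w1 + ((-1) * (u * w2)
      + (1 / z * (a * - w1 + (u * - w1 + ((3 * \<alpha> * a\<^sup>2 + \<beta>) * u
          + (3 * \<alpha> * a * (u * u) + \<alpha> * (u * (u * u))))))
     + (6 * \<gamma> * a\<^sup>2 * (u * u) + (4 * \<gamma> * a * (u * (u * u)) + \<gamma> * ((u * u) * (u * u)))))))
     = a * w2 + (- (4 * \<gamma> * a ^ 3)) * u"
    using has_lap_unique by blast
  show ?thesis using E a4 unfolding w_def u_def[symmetric] by algebra
qed

lemma lap_has_expansion:
  assumes f: "f holomorphic_on D" and b: "\<And>x. x \<in> D \<Longrightarrow> norm (f x) \<le> K * exp (c * norm x)"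
    and c: "c \<ge> 0" and K: "K \<ge> 0" and F: "eventually (\<lambda>z. c + 1 \<le> Re (z * e)) F"
  shows "has_expansion F (lap f) (laplace_fps f)"
  unfolding has_expansion_def
proof
  fix n
  show "(\<lambda>z. lap f z - (\<Sum>p<n. fps_nth (laplace_fps f) p / z ^ p)) \<in> O[F](\<lambda>z. 1 / z ^ n)"
  proof (rule bigoI)
    show "\<forall>\<^sub>F z in F. norm (lap f z - (\<Sum>p<n. fps_nth (laplace_fps f) p / z ^ p)) \<le>
       K * exp (c * \<rho>) * (1 + \<rho>) * fact n * (1 / \<rho>) ^ n * norm (1 / z ^ n)"
      using F
    proof eventually_elim
      case (elim z)
      then have "z \<noteq> 0" using c by auto
      then have "norm z ^ n > 0" by simp
      then show ?case using lap_gevrey_asymptotics[OF f b c K elim, of n]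
        by (simp add: norm_divide norm_power pos_le_divide_eq mult.commute)
    qed
  qed
qed

end

text \<open>
  On the ray itself, \<open>x\<^sup>2 / e\<^sup>2 = t\<^sup>2\<close> is real and \<open>s / e\<^sup>2\<close> is imaginary, so their difference has modulus
  at least \<open>(t\<^sup>2 + norm s) / 2\<close>. The radius \<open>r\<close> is so small that moving off the ray by \<open>r\<close> changes
  \<open>x\<^sup>2\<close> by at most half of this.
\<close>
lemma symbol_lower_bound:
  fixes e s :: complex and r t :: real
  assumes e: "norm e = 1" and s: "Re (s / e\<^sup>2) = 0" "s \<noteq> 0" and r: "r = sqrt (norm s / 20)"
    and t: "t \<ge> 0" and x: "norm (x - t *\<^sub>R e) \<le> r"
  shows "1 + (norm x)\<^sup>2 \<le> (8 + 4 / norm s) * norm (x\<^sup>2 - s)"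
proof -
  define \<Lambda> where "\<Lambda> = norm s"
  have \<Lambda>: "\<Lambda> > 0" using s by (simp add: \<Lambda>_def)
  have r2: "r\<^sup>2 = \<Lambda> / 20" "r \<ge> 0" using \<Lambda> by (auto simp: r \<Lambda>_def)
  have e0: "e \<noteq> 0" using e by auto
  define h where "h = x - t *\<^sub>R e"
  define y where "y = s / e\<^sup>2"
  have y: "Re y = 0" "\<bar>Im y\<bar> = \<Lambda>"
    using s e by (auto simp: y_def \<Lambda>_def cmod_eq_Im[symmetric] norm_divide norm_power)
  have xh: "x = t *\<^sub>R e + h" "norm h \<le> r" using x by (auto simp: h_def)
  have "s = e\<^sup>2 * y" using e0 by (simp add: y_def)
  then have "norm ((t *\<^sub>R e)\<^sup>2 - s) = norm (e\<^sup>2 * (of_real (t\<^sup>2) - y))"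
    by (simp add: scaleR_conv_of_real power_mult_distrib algebra_simps)
  also have "\<dots> = norm (of_real (t\<^sup>2) - y)" by (simp add: norm_mult norm_power e)
  finally have n: "norm ((t *\<^sub>R e)\<^sup>2 - s) = norm (of_real (t\<^sup>2) - y)" .
  define N where "N = norm (of_real (t\<^sup>2) - y)"
  have "t\<^sup>2 \<le> N" "\<Lambda> \<le> N" unfolding N_def
    using abs_Re_le_cmod[of "of_real (t\<^sup>2) - y"] abs_Im_le_cmod[of "of_real (t\<^sup>2) - y"] y by auto
  then have 1: "(t\<^sup>2 + \<Lambda>) / 2 \<le> norm ((t *\<^sub>R e)\<^sup>2 - s)" unfolding n N_def[symmetric] using add_mono[of "t\<^sup>2" N \<Lambda> N] by simp
  have "norm (h * (2 * (t *\<^sub>R e) + h)) \<le> r * (2 * t + r)"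
    unfolding norm_mult using xh(2) t e r2
    by (intro mult_mono order_trans[OF norm_triangle_ineq] add_mono) (auto simp: norm_mult)
  also have "\<dots> \<le> t\<^sup>2 / 4 + 5 * r\<^sup>2"
    using zero_le_power2[of "t / 2 - 2 * r"] by (simp add: power2_eq_square algebra_simps)
  finally have 2: "norm (h * (2 * (t *\<^sub>R e) + h)) \<le> t\<^sup>2 / 4 + \<Lambda> / 4" using r2 by simp
  have "x\<^sup>2 - s = ((t *\<^sub>R e)\<^sup>2 - s) + h * (2 * (t *\<^sub>R e) + h)"
    unfolding xh(1) by (simp add: power2_eq_square algebra_simps)
  then have "norm ((t *\<^sub>R e)\<^sup>2 - s) - norm (h * (2 * (t *\<^sub>R e) + h)) \<le> norm (x\<^sup>2 - s)"
    by (metis norm_diff_ineq)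
  then have 3: "(t\<^sup>2 + \<Lambda>) / 4 \<le> norm (x\<^sup>2 - s)" using 1 2 by simp
  have "norm x \<le> t + r" using norm_triangle_le[of "t *\<^sub>R e" h "t + r"] xh t e by simp
  then have "(norm x)\<^sup>2 \<le> (t + r)\<^sup>2" by (intro power_mono) auto
  also have "\<dots> \<le> 2 * t\<^sup>2 + 2 * r\<^sup>2" using zero_le_power2[of "t - r"] by (simp add: power2_eq_square algebra_simps)
  finally have "1 + (norm x)\<^sup>2 \<le> 1 + 2 * t\<^sup>2 + \<Lambda> / 10" using r2 by simp
  also have "\<dots> \<le> (8 + 4 / \<Lambda>) * ((t\<^sup>2 + \<Lambda>) / 4)"
  proof -
    have "(8 + 4 / \<Lambda>) * ((t\<^sup>2 + \<Lambda>) / 4) = 2 * t\<^sup>2 + 2 * \<Lambda> + t\<^sup>2 / \<Lambda> + 1"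
      using \<Lambda> by (simp add: field_simps)
    moreover have "0 \<le> t\<^sup>2 / \<Lambda>" using \<Lambda> by simp
    ultimately show ?thesis using \<Lambda> by simp
  qed
  also have "\<dots> \<le> (8 + 4 / \<Lambda>) * norm (x\<^sup>2 - s)" using 3 \<Lambda> by (intro mult_left_mono) auto
  finally show ?thesis by (simp add: \<Lambda>_def)
qed


lemma convex_ray_neighbourhood: "convex (\<Union>t\<in>{0..}. ball (t *\<^sub>R (e::complex)) r)"
proof -
  have "convex ((\<lambda>t. t *\<^sub>R e) ` {0..})"
    by (intro convex_linear_image bounded_linear.linear[OF bounded_linear_scaleR_left]) auto
  then have "convex (\<Union>x\<in>(\<lambda>t. t *\<^sub>R e) ` {0..}. \<Union>y\<in>ball 0 r. {x + y})"
    by (intro convex_sums) auto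
  also have "(\<Union>x\<in>(\<lambda>t. t *\<^sub>R e) ` {0..}. \<Union>y\<in>ball 0 r. {x + y}) = (\<Union>t\<in>{0..}. ball (t *\<^sub>R e) r)"
  proof (intro equalityI subsetI)
    fix x assume "x \<in> (\<Union>t\<in>{0..}. ball (t *\<^sub>R e) r)"
    then obtain t where "t \<ge> 0" "x - t *\<^sub>R e \<in> ball 0 r" by (auto simp: dist_norm norm_minus_commute)
    then show "x \<in> (\<Union>x\<in>(\<lambda>t. t *\<^sub>R e) ` {0..}. \<Union>y\<in>ball 0 r. {x + y})"
      by (intro UN_I[of "t *\<^sub>R e"] UN_I[of "x - t *\<^sub>R e"]) auto
  next
    fix x assume "x \<in> (\<Union>x\<in>(\<lambda>t. t *\<^sub>R e) ` {0..}. \<Union>y\<in>ball 0 r. {x + y})"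
    then obtain t y where "t \<ge> 0" "norm y < r" "x = t *\<^sub>R e + y" by auto
    then show "x \<in> (\<Union>t\<in>{0..}. ball (t *\<^sub>R e) r)"
      by (intro UN_I[of t]) (simp_all add: dist_norm)
  qed
  finally show ?thesis .
qed

text \<open>
  Borel summation in the direction \<open>e\<close>: one function solves the equation on a half-plane and has there,
  uniformly, the expansion given by the formal solution. The hypothesis on \<open>e\<close> keeps the ray
  away from the two zeros of the symbol.
\<close>
lemma half_plane_solution:
  fixes \<alpha> \<beta> \<gamma> \<delta> a e :: complex
  assumes a4: "\<gamma> * a ^ 4 + \<delta> = 0" and a: "a \<noteq> 0" and \<gamma>: "\<gamma> \<noteq> 0"
    and e: "norm e = 1" and s: "Re (4 * \<gamma> * a\<^sup>2 / e\<^sup>2) = 0"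
  obtains w F b C A where "b > 0" "C > 0" "A > 0"
    "fps_nth F 0 = a" "fps_const \<gamma> * F ^ 4 + fps_const \<delta> = fps_X * piii_rhs \<alpha> \<beta> F"
    "\<And>n. norm (fps_nth F n) \<le> C * fact n * A ^ n"
    "\<And>z n. b < Re (z * e) \<Longrightarrow> n \<ge> 1 \<Longrightarrow>
       norm z ^ n * norm (w z - (\<Sum>p<n. fps_nth F p / z ^ p)) < C * fact n * A ^ n"
    "piii_solution_on \<alpha> \<beta> \<gamma> \<delta> w {z. b < Re (z * e)}"
proof -
  define r where "r = sqrt (norm (4 * \<gamma> * a\<^sup>2) / 20)"
  have r: "r > 0" using a \<gamma> by (simp add: r_def)
  define D where "D = (\<Union>t\<in>{0..}. ball (t *\<^sub>R e) r)"
  have D: "open D" "convex D" unfolding D_def by (auto simp: convex_ray_neighbourhood)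
  have strip: "cball (t *\<^sub>R e) (r / 2) \<subseteq> D" if "t \<ge> 0" for t
    using that r by (force simp: D_def)
  have ray: "t *\<^sub>R e \<in> D" if "t \<ge> 0" for t
    using that r by (force simp: D_def)
  interpret laplace_strip D e "r / 2"
    using D e ray strip r by unfold_locales auto
  have D0: "0 \<in> D" using ray[of 0] by simp
  have low: "1 + (norm x)\<^sup>2 \<le> (8 + 4 / norm (4 * \<gamma> * a\<^sup>2)) * norm (x\<^sup>2 - 4 * \<gamma> * a\<^sup>2)" if xD: "x \<in> D" for x
  proof -
    obtain t where t: "t \<ge> 0" "norm (x - t *\<^sub>R e) < r"
      using xD by (auto simp: D_def dist_norm norm_minus_commute)
    show ?thesis by (rule symbol_lower_bound[OF e s _ r_def t(1)]) (use t a \<gamma> in auto)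
  qed
  obtain f c K where f: "f holomorphic_on D" and c: "c \<ge> 0" and K: "K \<ge> 0"
    and b: "\<And>x. x \<in> D \<Longrightarrow> norm (f x) \<le> K * exp (c * norm x)"
    and eq: "\<And>x. x \<in> D \<Longrightarrow> a * (x\<^sup>2 - 4 * \<gamma> * a\<^sup>2) * f x = (\<alpha> * a ^ 3 + \<beta> * a) + borel_nonlinearity \<alpha> \<beta> \<gamma> a f x"
    by (rule piii_convolution_equation_solvable[OF D D0 a low, where \<alpha>=\<alpha> and \<beta>=\<beta>]) (assumption, rule that)
  define f1 where "f1 x = - (x * f x)" for x
  define f2 where "f2 x = - (x * f1 x)" for x
  have f1: "f1 holomorphic_on D" and f2: "f2 holomorphic_on D"
    using f by (auto simp: f1_def[abs_def] f2_def[abs_def] intro!: holomorphic_intros)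
  have b1: "norm (f1 x) \<le> K * exp ((c + 1) * norm x)" if "x \<in> D" for x
    using norm_mult_ident_le[OF b[OF that]] by (simp add: f1_def)
  have b2: "norm (f2 x) \<le> K * exp ((c + 2) * norm x)" if "x \<in> D" for x
    using norm_mult_ident_le[OF b1[OF that]] by (simp add: f2_def add.commute)
  define w where "w z = a + lap f z" for z
  define P where "P = fps_const a + laplace_fps f"
  \<comment> \<open>The summand \<open>3\<close> leaves room for two derivatives, which raise the growth rate by \<open>2\<close>, and for the
     uniform bounds; the last summand forces \<open>norm (lap f z) < norm a\<close>, so that \<open>w\<close> has no zeros.\<close>
  define x0 where "x0 = c + 3 + K / norm a"
  define H where "H = {z. x0 < Re (z * e)}"
  have x0: "x0 \<ge> c + 3" using K by (simp add: x0_def)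
  have zH: "c + 3 \<le> Re (z * e)" if "z \<in> H" for z using that x0 by (simp add: H_def)
  have H: "open H" unfolding H_def by (intro open_Collect_less continuous_intros)
  have dw: "(w has_field_derivative lap f1 z) (at z)" if "z \<in> H" for z
  proof -
    have "(lap f has_field_derivative lap (\<lambda>x. - (x * f x)) z) (at z)"
      by (rule has_field_derivative_lap[OF f, of K c]) (use b[OF ray] zH[OF that] in \<open>auto simp: norm_e\<close>)
    then show ?thesis unfolding w_def f1_def[abs_def] by (auto intro!: derivative_eq_intros)
  qed
  have dw1: "(lap f1 has_field_derivative lap f2 z) (at z)" if "z \<in> H" for z
    unfolding f2_def[abs_def]
    by (rule has_field_derivative_lap[OF f1, of K "c + 1"]) (use b1[OF ray] zH[OF that] in \<open>auto simp: norm_e\<close>)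
  have d1: "deriv w z = lap f1 z" if "z \<in> H" for z using dw[OF that] by (rule DERIV_imp_deriv)
  have d2: "deriv (deriv w) z = lap f2 z" if "z \<in> H" for z
    by (rule DERIV_imp_deriv, rule has_field_derivative_transform_within_open[OF dw1[OF that] H that]) (simp add: d1)
  have E: "w z * lap f2 z - (lap f1 z)\<^sup>2 + 1 / z * (w z * lap f1 z) - 1 / z * (\<alpha> * w z ^ 3 + \<beta> * w z) - \<gamma> * w z ^ 4 - \<delta> = 0"
    if "c + 3 \<le> Re (z * e)" for z
  proof -
    have "c + 2 < Re (z * e)" using that by simp
    from lap_solves_piii[OF f c b eq a4 this] show ?thesis
      unfolding w_def f2_def f1_def .
  qed
  have sol: "piii_solution_on \<alpha> \<beta> \<gamma> \<delta> w H"
    unfolding piii_solution_on_def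
  proof (intro conjI ballI)
    show "w holomorphic_on H" using dw H by (auto simp: holomorphic_on_open)
    fix z assume z: "z \<in> H"
    have z0: "z \<noteq> 0" using zH[OF z] c by auto
    show w0: "w z \<noteq> 0"
    proof
      assume "w z = 0"
      then have "lap f z = - a" by (simp add: w_def eq_neg_iff_add_eq_0 add.commute)
      moreover have "norm (lap f z) \<le> K / (Re (z * e) - c)"
        by (rule has_lap_bounded(2)[OF f]) (use b[OF ray] zH[OF z] in \<open>auto simp: norm_e\<close>)
      moreover have "K < norm a * (Re (z * e) - c)"
      proof -
        have "norm a * (3 + K / norm a) < norm a * (Re (z * e) - c)"
          using z a by (intro mult_strict_left_mono) (auto simp: H_def x0_def)
        moreover have "norm a * (3 + K / norm a) = 3 * norm a + K" using a by (simp add: field_simps)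
        ultimately show ?thesis using norm_ge_zero[of a] by linarith
      qed
      ultimately show False using zH[OF z] by (simp add: le_divide_eq)
    qed
    define y where "y = 1 / z"
    have y: "q / z = y * q" for q by (simp add: y_def)
    have "((deriv w z)\<^sup>2 / w z - deriv w z / z + (\<alpha> * (w z)\<^sup>2 + \<beta>) / z + \<gamma> * w z ^ 3 + \<delta> / w z) * w z
        = (deriv w z)\<^sup>2 - y * deriv w z * w z + y * (\<alpha> * (w z)\<^sup>2 + \<beta>) * w z + \<gamma> * w z ^ 3 * w z + \<delta>"
      using w0 by (simp add: y distrib_right left_diff_distrib)
    also have "\<dots> = deriv (deriv w) z * w z"
      using E[OF zH[OF z]] unfolding d1[OF z] d2[OF z] y_def[symmetric] by algebra
    finally have "((deriv w z)\<^sup>2 / w z - deriv w z / z + (\<alpha> * (w z)\<^sup>2 + \<beta>) / z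
          + \<gamma> * w z ^ 3 + \<delta> / w z) * w z = deriv (deriv w) z * w z" .
    from this[symmetric]
    show "deriv (deriv w) z = (deriv w z)\<^sup>2 / w z - deriv w z / z + (\<alpha> * (w z)\<^sup>2 + \<beta>) / z
          + \<gamma> * w z ^ 3 + \<delta> / w z"
      using mult_right_cancel[OF w0] by blast
  qed
  have formal: "fps_const \<gamma> * P ^ 4 + fps_const \<delta> = fps_X * piii_rhs \<alpha> \<beta> P"
  proof (rule piii_formal_equation_of_derivatives)
    \<comment> \<open>Expansions along the axis of the half-plane are enough to determine the series.\<close>
    define G where "G = filtermap (\<lambda>t::real. of_real t * cnj e) at_top"
    have ee: "e * cnj e = 1" using e by (simp add: complex_norm_square[symmetric])
    have "LIM t at_top. of_real t * cnj e :> at_infinity"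
      unfolding filterlim_at_infinity[OF order_refl]
    proof (intro allI impI)
      fix r :: real
      show "\<forall>\<^sub>F t in at_top. r \<le> norm (of_real t * cnj e)"
        using eventually_ge_at_top[of "max r 0"] by eventually_elim (simp add: norm_mult e)
    qed
    then have G: "G \<le> at_infinity" by (simp add: G_def filterlim_def)
    have Gbot: "G \<noteq> bot" by (simp add: G_def filtermap_bot_iff)
    have ev: "eventually (\<lambda>z. c + 3 \<le> Re (z * e)) G"
      unfolding G_def eventually_filtermap
      using eventually_ge_at_top[of "c + 3"] by eventually_elim (simp add: mult.assoc mult.commute[of "cnj e"] ee)
    have x: "has_expansion G (lap f) (laplace_fps f)"
      by (rule lap_has_expansion[OF f b c K]) (assumption, rule eventually_mono[OF ev], simp)
    have xw: "has_expansion G w P" unfolding w_def[abs_def] P_def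
      by (intro has_expansion_add has_expansion_const G x)
    have x1: "has_expansion G (lap f1) (laplace_fps f1)"
      by (rule lap_has_expansion[OF f1 b1 _ K]) (use c in simp_all, rule eventually_mono[OF ev], simp)
    have x2: "has_expansion G (lap f2) (laplace_fps f2)"
      by (rule lap_has_expansion[OF f2 b2 _ K]) (use c in simp_all, rule eventually_mono[OF ev], simp)
    show "laplace_fps f1 = - (fps_X\<^sup>2 * fps_deriv P)"
      unfolding f1_def[abs_def] laplace_fps_mult_ident[OF D(1) D0 f] P_def by simp
    show "laplace_fps f2 = - (fps_X\<^sup>2 * fps_deriv (laplace_fps f1))"
      unfolding f2_def[abs_def] by (rule laplace_fps_mult_ident[OF D(1) D0 f1])
    have "has_expansion G (\<lambda>z. w z * lap f2 z - (lap f1 z)\<^sup>2 + 1 / z * (w z * lap f1 z) - 1 / z * (\<alpha> * w z ^ 3 + \<beta> * w z) - \<gamma> * w z ^ 4 - \<delta>)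
      (P * laplace_fps f2 - (laplace_fps f1)\<^sup>2 + fps_X * (P * laplace_fps f1) - fps_X * (fps_const \<alpha> * P ^ 3 + fps_const \<beta> * P)
        - fps_const \<gamma> * P ^ 4 - fps_const \<delta>)"
      by (intro has_expansion_add has_expansion_diff has_expansion_mult has_expansion_power has_expansion_const
          has_expansion_inverse G xw x1 x2)
    then have "has_expansion G (\<lambda>_. 0) (P * laplace_fps f2 - (laplace_fps f1)\<^sup>2 + fps_X * (P * laplace_fps f1) - fps_X * (fps_const \<alpha> * P ^ 3 + fps_const \<beta> * P)
        - fps_const \<gamma> * P ^ 4 - fps_const \<delta>)"
      by (rule has_expansion_cong[OF G]) (rule eventually_mono[OF ev E])
    then show "P * laplace_fps f2 - (laplace_fps f1)\<^sup>2 + fps_X * (P * laplace_fps f1) - fps_X * (fps_const \<alpha> * P ^ 3 + fps_const \<beta> * P)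
        - fps_const \<gamma> * P ^ 4 - fps_const \<delta> = 0"
      by (rule has_expansion_zero_unique[OF G _ Gbot])
  qed
  define A where "A = 1 / (r / 2)"
  define C where "C = norm a + K * exp (c * (r / 2)) * (1 + r / 2) + 1"
  have A: "A > 0" using r by (simp add: A_def)
  have C1: "K * exp (c * (r / 2)) * (r / 2) \<le> C" "K * exp (c * (r / 2)) * (1 + r / 2) < C" "norm a \<le> C" "C > 0"
  proof -
    have k: "0 \<le> K * exp (c * (r / 2))" using K by simp
    have "0 \<le> K * exp (c * (r / 2)) * (1 + r / 2)" using mult_nonneg_nonneg[OF k, of "1 + r / 2"] r by simp
    moreover have "K * exp (c * (r / 2)) * (r / 2) \<le> K * exp (c * (r / 2)) * (1 + r / 2)"
      using k by (intro mult_left_mono) auto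
    ultimately show "K * exp (c * (r / 2)) * (r / 2) \<le> C" "K * exp (c * (r / 2)) * (1 + r / 2) < C" "norm a \<le> C" "C > 0"
      using norm_ge_zero[of a] unfolding C_def by linarith+
  qed
  have L0: "fps_nth (laplace_fps f) 0 = 0" by (simp add: laplace_fps_def)
  show thesis
  proof (rule that)
    show "x0 > 0" using x0 c by simp
    show "C > 0" "A > 0" by fact+
    show "fps_nth P 0 = a" by (simp add: P_def L0)
    show "fps_const \<gamma> * P ^ 4 + fps_const \<delta> = fps_X * piii_rhs \<alpha> \<beta> P" by fact
    show "piii_solution_on \<alpha> \<beta> \<gamma> \<delta> w {z. x0 < Re (z * e)}" using sol by (simp add: H_def)
    show "norm (fps_nth P n) \<le> C * fact n * A ^ n" for n
    proof (cases "n = 0")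
      case True
      then show ?thesis using C1 by (simp add: P_def L0)
    next
      case False
      have "norm (fps_nth P n) = norm (fps_nth (laplace_fps f) n)" using False by (simp add: P_def)
      also have "\<dots> \<le> K * exp (c * (r / 2)) * (r / 2) * fact n * A ^ n"
        unfolding A_def by (rule norm_laplace_fps_le[OF f b c K])
      also have "\<dots> \<le> C * fact n * A ^ n" using C1(1) A by (intro mult_right_mono) auto
      finally show ?thesis .
    qed
    fix z and n :: nat assume z: "x0 < Re (z * e)" and n: "n \<ge> 1"
    have "(\<Sum>p<n. fps_nth P p / z ^ p) = a + (\<Sum>p<n. fps_nth (laplace_fps f) p / z ^ p)"
    proof -
      have "(\<Sum>p<n. fps_nth (fps_const a) p / z ^ p) = a"
        using n by (subst sum.remove[of _ 0]) auto
      then show ?thesis by (simp add: P_def add_divide_distrib sum.distrib)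
    qed
    then have "norm z ^ n * norm (w z - (\<Sum>p<n. fps_nth P p / z ^ p)) \<le> K * exp (c * (r / 2)) * (1 + r / 2) * fact n * A ^ n"
      using lap_gevrey_asymptotics[OF f b c K, of z n] z x0 by (simp add: w_def A_def)
    also have "\<dots> < C * fact n * A ^ n" using C1(2) A by (intro mult_strict_right_mono) auto
    finally show "norm z ^ n * norm (w z - (\<Sum>p<n. fps_nth P p / z ^ p)) < C * fact n * A ^ n" .
  qed
qed

section \<open>Covering all narrow sectors\<close>

lemma piii_solution_on_subset:
  "piii_solution_on \<alpha> \<beta> \<gamma> \<delta> w V \<Longrightarrow> U \<subseteq> V \<Longrightarrow> piii_solution_on \<alpha> \<beta> \<gamma> \<delta> w U"
  by (auto simp: piii_solution_on_def intro: holomorphic_on_subset)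

lemma piii_initial_value:
  assumes "\<gamma> \<noteq> 0" "\<delta> \<noteq> 0"
  shows "\<gamma> * (\<i> ^ l * piii_root4 \<gamma> \<delta>) ^ 4 + \<delta> = 0" "\<i> ^ l * piii_root4 \<gamma> \<delta> \<noteq> 0"
    "(\<i> ^ l * piii_root4 \<gamma> \<delta>)\<^sup>2 = (-1) ^ l * (piii_root4 \<gamma> \<delta>)\<^sup>2"
proof -
  have "piii_root4 \<gamma> \<delta> ^ 4 = (- \<delta> / \<gamma>) powr 1"
    unfolding piii_root4_def by (simp flip: powr_add add: eval_nat_numeral)
  moreover have "(\<i> ^ l) ^ 4 = (1 :: complex)"
    by (simp flip: power_mult add: mult.commute[of l] power_mult)
  ultimately show "\<gamma> * (\<i> ^ l * piii_root4 \<gamma> \<delta>) ^ 4 + \<delta> = 0"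
    using assms by (simp add: power_mult_distrib)
  show "\<i> ^ l * piii_root4 \<gamma> \<delta> \<noteq> 0" using assms by (simp add: piii_root4_def)
  show "(\<i> ^ l * piii_root4 \<gamma> \<delta>)\<^sup>2 = (-1) ^ l * (piii_root4 \<gamma> \<delta>)\<^sup>2"
    by (simp add: power_mult_distrib flip: power_mult)
qed

lemma piii_series_eqI:
  assumes "\<gamma> \<noteq> 0" "\<delta> \<noteq> 0" "fps_nth F 0 = \<i> ^ l * piii_root4 \<gamma> \<delta>"
    "fps_const \<gamma> * F ^ 4 + fps_const \<delta> = fps_X * piii_rhs \<alpha> \<beta> F"
  shows "piii_series \<alpha> \<beta> \<gamma> \<delta> l = F"
proof -
  have "is_piii_series \<alpha> \<beta> \<gamma> \<delta> l (piii_series \<alpha> \<beta> \<gamma> \<delta> l)"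
    unfolding piii_series_def by (rule theI'[OF ex1_piii_series[OF assms(1,2)]])
  then show ?thesis
    using ex1_piii_fps[OF piii_initial_value(1)[OF assms(1,2)] assms(1) piii_initial_value(2)[OF assms(1,2)]] assms(3,4)
    unfolding is_piii_series_def piii_formal_solution_iff by blast
qed

text \<open>
  One of the two coordinates of a unit vector has absolute value at least \<open>1 / sqrt 2 > 7/10\<close>, and a
  power of \<open>\<i>\<close> turns it into a positive real part.
\<close>
lemma quarter_turn_near_positive_axis:
  assumes "norm v = 1"
  obtains j :: nat where "j < 4" "7 / 10 \<le> Re (\<i> ^ j * v)"
proof -
  have "(Re v)\<^sup>2 + (Im v)\<^sup>2 = 1" using assms by (simp add: cmod_def)
  moreover have "x\<^sup>2 < 1 / 2" if "\<bar>x\<bar> < 7 / 10" for x :: real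
  proof -
    have "\<bar>x\<bar>\<^sup>2 < (7 / 10)\<^sup>2" using that by (intro power_strict_mono) auto
    then show ?thesis by (simp add: power2_eq_square)
  qed
  ultimately have "7 / 10 \<le> \<bar>Re v\<bar> \<or> 7 / 10 \<le> \<bar>Im v\<bar>" by (smt (verit) field_sum_of_halves)
  then consider "7 / 10 \<le> Re v" | "7 / 10 \<le> - Im v" | "7 / 10 \<le> - Re v" | "7 / 10 \<le> Im v" by linarith
  then show thesis
  proof cases
    case 1 then show ?thesis using that[of 0] by simp
  next
    case 2 then show ?thesis using that[of 1] by simp
  next
    case 3 then show ?thesis using that[of 2] by simp
  next
    case 4 then show ?thesis using that[of 3] by (simp add: power3_eq_cube)
  qed
qed

text \<open>
  Rotating by an angle \<open>\<tau>\<close> moves a point of the unit circle by at most \<open>\<bar>\<tau>\<bar>\<close>, so a real part of at least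
  \<open>7/10\<close> remains at least \<open>1/5\<close> when \<open>\<bar>\<tau>\<bar> \<le> 1/2\<close>. Sectors of opening below \<open>pi / 4\<close> deviate from their
  axis by less than \<open>pi / 8 < 1/2\<close>.
\<close>
lemma Re_mult_ge_of_near_direction:
  assumes v: "7 / 10 \<le> Re (d * cis \<phi>)" "norm d = 1" and \<theta>: "is_Arg z \<theta>" "\<bar>\<theta> - \<phi>\<bar> \<le> 1 / 2"
  shows "norm z / 5 \<le> Re (z * d)"
proof -
  define \<tau> where "\<tau> = \<theta> - \<phi>"
  have "norm (cis \<tau> - 1) \<le> \<bar>\<tau>\<bar>"
    using dist_exp_i_1[of \<tau>] abs_sin_x_le_abs_x[of "\<tau> / 2"] by (simp add: cis_conv_exp)
  then have c: "norm (cis \<tau> - 1) \<le> 1 / 2" using \<theta> by (simp add: \<tau>_def)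
  define p where "p = d * cis \<phi>"
  have "- Re (p * (cis \<tau> - 1)) \<le> norm (p * (cis \<tau> - 1))"
    using abs_Re_le_cmod[of "p * (cis \<tau> - 1)"] by linarith
  also have "\<dots> = norm (cis \<tau> - 1)" using v by (simp add: p_def norm_mult)
  finally have "1 / 5 \<le> Re p + Re (p * (cis \<tau> - 1))" using c v by (simp add: p_def)
  also have "\<dots> = Re (p * cis \<tau>)" by (simp add: algebra_simps)
  also have "p * cis \<tau> = d * cis \<theta>" by (simp add: p_def \<tau>_def cis_mult mult.assoc)
  finally have "norm z * (1 / 5) \<le> norm z * Re (d * cis \<theta>)" by (intro mult_left_mono) auto
  also have "\<dots> = Re (of_real (norm z) * cis \<theta> * d)" by (simp add: algebra_simps)
  also have "of_real (norm z) * cis \<theta> = z"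
    using \<theta>(1) by (simp add: is_Arg_def cis_conv_exp)
  finally show ?thesis by simp
qed

theorem theorem4:
  fixes \<alpha> \<beta> \<gamma> \<delta> :: complex
  assumes "\<alpha> * \<beta> * \<gamma> * \<delta> \<noteq> 0"
  shows "(\<forall>l\<in>{1..4::nat}. gevrey_order_1 (piii_series \<alpha> \<beta> \<gamma> \<delta> l)) \<and>
    (\<exists>k'\<ge>1::real. \<exists>R0>0::real. \<forall>(R::real) (\<phi>1::real) (\<phi>2::real).
       R \<ge> R0 \<and> \<phi>1 < \<phi>2 \<and> \<phi>2 - \<phi>1 < pi / k' \<longrightarrow>
       (\<forall>l\<in>{1..4::nat}. \<exists>w.
          piii_solution_on \<alpha> \<beta> \<gamma> \<delta> w (open_sector_inf R \<phi>1 \<phi>2) \<and>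
          gevrey_1_approx_on w (piii_series \<alpha> \<beta> \<gamma> \<delta> l) (open_sector_inf R \<phi>1 \<phi>2)))"
proof -
  have \<gamma>: "\<gamma> \<noteq> 0" and \<delta>: "\<delta> \<noteq> 0" using assms by auto
  define F where "F = piii_series \<alpha> \<beta> \<gamma> \<delta>"
  define s where "s = 4 * \<gamma> * (piii_root4 \<gamma> \<delta>)\<^sup>2"
  have s: "s \<noteq> 0" using piii_initial_value(2)[OF \<gamma> \<delta>, of 0] \<gamma> by (simp add: s_def)
  \<comment> \<open>All four leading coefficients have \<open>4 \<gamma> a\<^sup>2 = \<plusminus> s\<close>, and the squares of the four directions are
     \<open>\<plusminus> \<i> s / norm s\<close>; so each direction is admissible for each series.\<close>
  define e where "e = csqrt (\<i> * s / norm s)"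
  define d where "d j = \<i> ^ j * e" for j :: nat
  have e2: "e\<^sup>2 = \<i> * s / norm s" by (simp add: e_def)
  then have "norm e ^ 2 = 1" using s by (simp flip: norm_power add: norm_divide norm_mult)
  then have "norm e = 1" using power2_eq_1_iff[of "norm e"] norm_ge_zero[of e] by linarith
  then have d: "norm (d j) = 1" for j by (simp add: d_def norm_mult norm_power)
  define good where "good l j b w C A \<longleftrightarrow> b > 0 \<and> C > 0 \<and> A > 0 \<and>
      (\<forall>n. norm (fps_nth (F l) n) \<le> C * fact n * A ^ n) \<and>
      (\<forall>z n. b < Re (z * d j) \<longrightarrow> n \<ge> 1 \<longrightarrow>
         norm z ^ n * norm (w z - (\<Sum>p<n. fps_nth (F l) p / z ^ p)) < C * fact n * A ^ n) \<and>
      piii_solution_on \<alpha> \<beta> \<gamma> \<delta> w {z. b < Re (z * d j)}" for l j b w C A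
  have ex: "\<exists>b w C A. good l j b w C A" for l j
  proof -
    define a where "a = \<i> ^ l * piii_root4 \<gamma> \<delta>"
    note a = piii_initial_value[OF \<gamma> \<delta>, of l, folded a_def]
    have "4 * \<gamma> * a\<^sup>2 / (d j)\<^sup>2 = ((-1) ^ l * s) / ((-1) ^ j * (\<i> * s / norm s))"
      by (simp add: a(3) s_def d_def power_mult_distrib e2[unfolded s_def] flip: power_mult)
    also have "Re \<dots> = 0"
      using s by (cases "even l"; cases "even j") (simp_all add: field_simps)
    finally have "Re (4 * \<gamma> * a\<^sup>2 / (d j)\<^sup>2) = 0" .
    then obtain w P b C A where P: "b > 0" "C > 0" "A > 0"
      "fps_nth P 0 = a" "fps_const \<gamma> * P ^ 4 + fps_const \<delta> = fps_X * piii_rhs \<alpha> \<beta> P"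
      "\<And>n. norm (fps_nth P n) \<le> C * fact n * A ^ n"
      "\<And>z n. b < Re (z * d j) \<Longrightarrow> n \<ge> 1 \<Longrightarrow>
        norm z ^ n * norm (w z - (\<Sum>p<n. fps_nth P p / z ^ p)) < C * fact n * A ^ n"
      "piii_solution_on \<alpha> \<beta> \<gamma> \<delta> w {z. b < Re (z * d j)}"
      by (rule half_plane_solution[OF a(1,2) \<gamma> d, where \<alpha>=\<alpha> and \<beta>=\<beta>]) (rule that)
    have "F l = P" unfolding F_def using piii_series_eqI[OF \<gamma> \<delta>] P(4,5) by (simp add: a_def)
    then have "good l j b w C A" using P by (simp add: good_def)
    then show ?thesis by blast
  qed
  then obtain b w C A where g: "\<And>l j. good l j (b l j) (w l j) (C l j) (A l j)" by metis
  \<comment> \<open>The sum of the sixteen positive thresholds is an upper bound for each of them.\<close>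
  define b0 where "b0 = (\<Sum>l\<in>{1..4}. \<Sum>j<4. b l j)"
  have bpos: "b l j > 0" for l j using g by (auto simp: good_def)
  have b0: "b l j \<le> b0" if "l \<in> {1..4}" "j < 4" for l j
  proof -
    have "b l j \<le> (\<Sum>j<4. b l j)"
      using that bpos by (intro member_le_sum) (auto intro: less_imp_le)
    also have "\<dots> \<le> b0" unfolding b0_def
      using that bpos by (intro member_le_sum) (auto intro!: sum_nonneg simp: less_imp_le)
    finally show ?thesis .
  qed
  have b0pos: "b0 > 0" using b0[of 1 0] bpos[of 1 0] by simp
  have sector: "\<exists>w. piii_solution_on \<alpha> \<beta> \<gamma> \<delta> w (open_sector_inf R \<phi>1 \<phi>2) \<and>
          gevrey_1_approx_on w (F l) (open_sector_inf R \<phi>1 \<phi>2)"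
    if R: "R \<ge> 5 * b0" and \<phi>: "\<phi>2 - \<phi>1 < pi / 4" and l: "l \<in> {1..4}" for R \<phi>1 \<phi>2 l
  proof -
    define \<phi> where "\<phi> = (\<phi>1 + \<phi>2) / 2"
    have "norm (e * cis \<phi>) = 1" using \<open>norm e = 1\<close> by (simp add: norm_mult)
    then obtain j where j: "j < 4" "7 / 10 \<le> Re (\<i> ^ j * (e * cis \<phi>))"
      by (rule quarter_turn_near_positive_axis)
    then have dj: "7 / 10 \<le> Re (d j * cis \<phi>)" by (simp add: d_def mult.assoc)
    have sub: "b l j < Re (z * d j)" if z: "z \<in> open_sector_inf R \<phi>1 \<phi>2" for z
    proof -
      obtain \<theta> where \<theta>: "is_Arg z \<theta>" "\<phi>1 < \<theta>" "\<theta> < \<phi>2" "norm z > R"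
        using z by (auto simp: open_sector_inf_def)
      have "\<bar>\<theta> - \<phi>\<bar> \<le> 1 / 2" using \<theta>(2,3) \<phi> pi_less_4 by (simp add: \<phi>_def abs_le_iff field_simps)
      from Re_mult_ge_of_near_direction[OF dj d \<theta>(1) this] show ?thesis
        using b0[OF l j(1)] R \<theta>(4) by linarith
    qed
    have "gevrey_1_approx_on (w l j) (F l) (open_sector_inf R \<phi>1 \<phi>2)"
      unfolding gevrey_1_approx_on_def
    proof (rule exI[of _ "C l j"], intro conjI allI impI)
      show "C l j > 0" using g by (simp add: good_def)
      fix Y assume Y: "closed_subsector Y (open_sector_inf R \<phi>1 \<phi>2)"
      show "\<exists>A>0. \<forall>z\<in>Y. \<forall>n\<ge>1. norm z ^ n * norm (w l j z - (\<Sum>p<n. fps_nth (F l) p / z ^ p)) < C l j * fact n * A ^ n"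
        using g[of l j] sub Y unfolding good_def closed_subsector_def by (intro exI[of _ "A l j"]) blast
    qed
    moreover have "piii_solution_on \<alpha> \<beta> \<gamma> \<delta> (w l j) (open_sector_inf R \<phi>1 \<phi>2)"
      by (rule piii_solution_on_subset[of _ _ _ _ _ "{z. b l j < Re (z * d j)}"])
         (use g[of l j] sub in \<open>auto simp: good_def\<close>)
    ultimately show ?thesis by blast
  qed
  have "gevrey_order_1 (F l)" for l
    using g[of l 0] unfolding gevrey_order_1_def good_def by blast
  moreover have "\<exists>k'\<ge>1::real. \<exists>R0>0::real. \<forall>(R::real) (\<phi>1::real) (\<phi>2::real).
       R \<ge> R0 \<and> \<phi>1 < \<phi>2 \<and> \<phi>2 - \<phi>1 < pi / k' \<longrightarrow>
       (\<forall>l\<in>{1..4::nat}. \<exists>w. piii_solution_on \<alpha> \<beta> \<gamma> \<delta> w (open_sector_inf R \<phi>1 \<phi>2) \<and>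
          gevrey_1_approx_on w (F l) (open_sector_inf R \<phi>1 \<phi>2))"
    using sector b0pos by (intro exI[of _ 4] exI[of _ "5 * b0"] conjI) auto
  ultimately show ?thesis unfolding F_def by blast
qed

end
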